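(* Let $0<r_1<r_2<r_3$ and let $S=\{C(r_1),C(r_2),C(r_3)\}$ be three distinct concentric circles. Then the perimeter $L$ is a Morse function on $M'(S)$ with exactly six critical points: four parades, of which the shortest one is the unique minimum and the other three are saddles, and two non-degenerate triangles, at which $L$ attains its global maximum. The values of $L$ at all critical points, given in increasing order, are $$L_m=2(r_3-r_1),\qquad 2(r_1+r_3),\qquad 2(r_2+r_3),$$ $$L_M=\sqrt{r_1^2+r_2^2+2t\,r_1r_2r_3^{-1}}+\sqrt{r_1^2+r_3^2+2t\,r_1r_3r_2^{-1}}+\sqrt{r_2^2+r_3^2+2t\,r_2r_3r_1^{-1}},$$ where $t$ is the unique positive real root of the cubic equation $$2r_1r_2r_3\,t^3+(r_1^2r_2^2+r_2^2r_3^2+r_3^2r_1^2)\,t^2-r_1^2r_2^2r_3^2=0.$$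
   Context: $C(r)$ is the circle of radius $r$ in the Euclidean plane centred at the origin $O$. An $S$-circuit is an ordered triple $P=(p_1,p_2,p_3)$ with $p_i\in C(r_i)$, with perimeter $L(P)=|p_1p_2|+|p_2p_3|+|p_3p_1|$. The reduced configuration space $M'(S)$ is the set of $S$-circuits with $p_3=(r_3,0)$ fixed; it is identified with the torus $\mathbb{T}^2$ via the polar angles of $p_1,p_2$, and $L$ is regarded as a function on it. A parade is an $S$-circuit all of whose vertices have polar angle $0$ or $\pi$; there are four parades in $M'(S)$, and the shortest parade is the one with all polar angles equal to $0$. A saddle is a non-degenerate critical point of Morse index one. *)

theory Defs
  imports "HOL-Analysis.Analysis"
begin

section \<open>Critical points, Hessians and Morse index\<close>

primrec continuously_differentiable ::
    "nat \<Rightarrow> ('a::euclidean_space \<Rightarrow> real) \<Rightarrow> bool" where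
  "continuously_differentiable 0 f \<longleftrightarrow> continuous_on UNIV f"
| "continuously_differentiable (Suc n) f \<longleftrightarrow>
     (\<forall>x. f differentiable (at x)) \<and>
     (\<forall>v. continuously_differentiable n (\<lambda>x. frechet_derivative f (at x) v))"

definition smooth :: "('a::euclidean_space \<Rightarrow> real) \<Rightarrow> bool" where
  "smooth f \<longleftrightarrow> (\<forall>n. continuously_differentiable n f)"

definition critical_point :: "('a::euclidean_space \<Rightarrow> real) \<Rightarrow> 'a \<Rightarrow> bool" where
  "critical_point f x \<longleftrightarrow> (f has_derivative (\<lambda>_. 0)) (at x)"

definition hessian :: "('a::euclidean_space \<Rightarrow> real) \<Rightarrow> 'a \<Rightarrow> 'a \<Rightarrow> 'a \<Rightarrow> real" where
  "hessian f x u v = frechet_derivative (\<lambda>y. frechet_derivative f (at y) u) (at x) v"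

definition nondegenerate_critical_point ::
    "('a::euclidean_space \<Rightarrow> real) \<Rightarrow> 'a \<Rightarrow> bool" where
  "nondegenerate_critical_point f x \<longleftrightarrow>
     critical_point f x \<and> (\<forall>u. (\<forall>v. hessian f x u v = 0) \<longrightarrow> u = 0)"

definition morse_index :: "('a::euclidean_space \<Rightarrow> real) \<Rightarrow> 'a \<Rightarrow> nat" where
  "morse_index f x =
     Max {dim V | V. subspace V \<and> (\<forall>v\<in>V. v \<noteq> 0 \<longrightarrow> hessian f x v v < 0)}"

definition saddle_point :: "('a::euclidean_space \<Rightarrow> real) \<Rightarrow> 'a \<Rightarrow> bool" where
  "saddle_point f x \<longleftrightarrow> nondegenerate_critical_point f x \<and> morse_index f x = 1"


section \<open>Circuits on three concentric circles\<close>

text \<open>The Euclidean plane is the type \<^typ>\<open>complex\<close>, the common centre is \<open>0\<close>.\<close>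

type_synonym circuit = "complex \<times> complex \<times> complex"

definition circuits :: "real \<Rightarrow> real \<Rightarrow> real \<Rightarrow> circuit set" where
  "circuits r1 r2 r3 = sphere 0 r1 \<times> sphere 0 r2 \<times> sphere 0 r3"

definition perimeter :: "circuit \<Rightarrow> real" where
  "perimeter = (\<lambda>(p1, p2, p3). dist p1 p2 + dist p2 p3 + dist p3 p1)"

definition reduced_circuits :: "real \<Rightarrow> real \<Rightarrow> real \<Rightarrow> circuit set" where
  "reduced_circuits r1 r2 r3 =
     {(p1, p2, p3). (p1, p2, p3) \<in> circuits r1 r2 r3 \<and> p3 = Complex r3 0}"

definition parade :: "circuit \<Rightarrow> bool" where
  "parade = (\<lambda>(p1, p2, p3). \<forall>p\<in>{p1, p2, p3}. Arg p = 0 \<or> Arg p = pi)"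

definition parades :: "real \<Rightarrow> real \<Rightarrow> real \<Rightarrow> circuit set" where
  "parades r1 r2 r3 = {P \<in> reduced_circuits r1 r2 r3. parade P}"

definition shortest_parade :: "real \<Rightarrow> real \<Rightarrow> real \<Rightarrow> circuit" where
  "shortest_parade r1 r2 r3 = (rcis r1 0, rcis r2 0, rcis r3 0)"

definition nondegenerate_triangle :: "circuit \<Rightarrow> bool" where
  "nondegenerate_triangle = (\<lambda>(p1, p2, p3). \<not> collinear {p1, p2, p3})"


section \<open>The reduced configuration space as a torus\<close>

text \<open>
  The covering of the torus by the plane of all pairs of polar angles is a local
  diffeomorphism. A function \<open>f\<close> on the torus is therefore studied through its doubly
  \<open>2\<pi>\<close>-periodic lift \<open>f \<circ> polar_circuit r1 r2 r3\<close>, and by periodicity the choice of the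
  preimage \<open>polar_angles P\<close> of \<open>P\<close> is immaterial.
\<close>

definition polar_circuit :: "real \<Rightarrow> real \<Rightarrow> real \<Rightarrow> real \<times> real \<Rightarrow> circuit" where
  "polar_circuit r1 r2 r3 = (\<lambda>(a1, a2). (rcis r1 a1, rcis r2 a2, Complex r3 0))"

definition polar_angles :: "circuit \<Rightarrow> real \<times> real" where
  "polar_angles = (\<lambda>(p1, p2, p3). (Arg p1, Arg p2))"

lemma polar_circuit_polar_angles:
  assumes "P \<in> reduced_circuits r1 r2 r3"
  shows "polar_circuit r1 r2 r3 (polar_angles P) = P"
  using assms
  by (auto simp: reduced_circuits_def circuits_def polar_circuit_def polar_angles_def
      rcis_cmod_Arg)

lemma polar_angles_polar_circuit:
  assumes "0 < r1" "0 < r2" "\<theta> \<in> {-pi<..pi} \<times> {-pi<..pi}"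
  shows "polar_angles (polar_circuit r1 r2 r3 \<theta>) = \<theta>"
  using assms
  by (auto simp: polar_circuit_def polar_angles_def Arg_rcis)

lemma range_polar_circuit:
  assumes "0 < r1" "0 < r2" "0 < r3"
  shows "range (polar_circuit r1 r2 r3) = reduced_circuits r1 r2 r3"
proof
  show "range (polar_circuit r1 r2 r3) \<subseteq> reduced_circuits r1 r2 r3"
    using assms by (auto simp: polar_circuit_def reduced_circuits_def circuits_def complex_norm)
  show "reduced_circuits r1 r2 r3 \<subseteq> range (polar_circuit r1 r2 r3)"
    by (metis polar_circuit_polar_angles rangeI subsetI)
qed

lemma polar_circuit_periodic:
  "polar_circuit r1 r2 r3 (a1 + 2 * pi, a2) = polar_circuit r1 r2 r3 (a1, a2)"
  "polar_circuit r1 r2 r3 (a1, a2 + 2 * pi) = polar_circuit r1 r2 r3 (a1, a2)"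
  by (simp_all add: polar_circuit_def rcis_def cis.code)

definition critical_circuits ::
    "real \<Rightarrow> real \<Rightarrow> real \<Rightarrow> (circuit \<Rightarrow> real) \<Rightarrow> circuit set" where
  "critical_circuits r1 r2 r3 f =
     {P \<in> reduced_circuits r1 r2 r3.
        critical_point (f \<circ> polar_circuit r1 r2 r3) (polar_angles P)}"

definition morse_function ::
    "real \<Rightarrow> real \<Rightarrow> real \<Rightarrow> (circuit \<Rightarrow> real) \<Rightarrow> bool" where
  "morse_function r1 r2 r3 f \<longleftrightarrow>
     smooth (f \<circ> polar_circuit r1 r2 r3) \<and>
     (\<forall>P \<in> critical_circuits r1 r2 r3 f.
        nondegenerate_critical_point (f \<circ> polar_circuit r1 r2 r3) (polar_angles P))"

definition saddle_circuit ::
    "real \<Rightarrow> real \<Rightarrow> real \<Rightarrow> (circuit \<Rightarrow> real) \<Rightarrow> circuit \<Rightarrow> bool" where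
  "saddle_circuit r1 r2 r3 f P \<longleftrightarrow>
     P \<in> reduced_circuits r1 r2 r3 \<and>
     saddle_point (f \<circ> polar_circuit r1 r2 r3) (polar_angles P)"

end

theory Submission
  imports Defs
begin

text \<open>
  In polar angles the perimeter is \<open>A(\<alpha>\<^sub>1 - \<alpha>\<^sub>2) + B(\<alpha>\<^sub>2) + C(\<alpha>\<^sub>1)\<close>, where the derivative of each
  chord length is the signed distance of its line from \<open>O\<close>. A circuit is therefore critical iff
  the three signed distances agree. If the common value is \<open>0\<close>, the circuit is a parade.
  Otherwise \<open>O\<close> is the incentre: the half angles \<open>\<beta>\<^sub>i\<close> satisfy \<open>sin \<beta>\<^sub>i = t / r\<^sub>i\<close>, where \<open>t\<close> is the
  inradius, and \<open>\<beta>\<^sub>1 + \<beta>\<^sub>2 + \<beta>\<^sub>3 = \<pi> / 2\<close> turns into the cubic. Such a \<open>t\<close> is unique, which leaves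
  one triangle and its mirror image. The Hessian determinant is \<open>A''B'' + B''C'' + C''A''\<close>; at a parade
  the numbers \<open>1 / A''\<close>, \<open>1 / B''\<close>, \<open>1 / C''\<close> are sums and differences of \<open>1 / r\<^sub>i\<close>, and at the
  triangles all three second derivatives are negative. The maximum, which exists by compactness, is
  found by comparing the critical values.
\<close>

section \<open>Chord lengths as functions of the central angle\<close>

text \<open>Law of cosines: the distance between points at distances \<open>p\<close> and
  \<open>q\<close> from the origin whose polar angles differ by \<open>x\<close>.\<close>

definition chord :: "real \<Rightarrow> real \<Rightarrow> real \<Rightarrow> real" where
  "chord p q x = sqrt (p\<^sup>2 + q\<^sup>2 - 2 * p * q * cos x)"

text \<open>\<open>p * q * sin x\<close> is twice the signed area of the triangle formed by the
  origin and the chord. Divided by the base, it is the signed distance of the origin from the line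
  of the chord.\<close>

definition chord_deriv :: "real \<Rightarrow> real \<Rightarrow> real \<Rightarrow> real" where
  "chord_deriv p q x = p * q * sin x / chord p q x"

text \<open>The formula comes from differentiating
  \<open>chord p q x * chord_deriv p q x = p * q * sin x\<close>, valid for distinct radii.\<close>

definition chord_deriv2 :: "real \<Rightarrow> real \<Rightarrow> real \<Rightarrow> real" where
  "chord_deriv2 p q x = (p * q * cos x - (chord_deriv p q x)\<^sup>2) / chord p q x"

lemma chord_arg_ge:
  fixes p q x :: real
  assumes "0 < p" "0 < q"
  shows "(p - q)\<^sup>2 \<le> p\<^sup>2 + q\<^sup>2 - 2 * p * q * cos x"
proof -
  have "p * q * cos x \<le> p * q * 1"
    using assms by (intro mult_left_mono) auto
  then show ?thesis by (simp add: power2_diff)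
qed

lemma chord_arg_pos:
  fixes p q x :: real
  assumes "0 < p" "0 < q" "p \<noteq> q"
  shows "0 < p\<^sup>2 + q\<^sup>2 - 2 * p * q * cos x"
proof -
  have "0 < (p - q)\<^sup>2" using assms(3) by simp
  then show ?thesis using chord_arg_ge[OF assms(1,2), of x] by (rule less_le_trans)
qed

lemma chord_pos: "0 < p \<Longrightarrow> 0 < q \<Longrightarrow> p \<noteq> q \<Longrightarrow> 0 < chord p q x"
  using chord_arg_pos by (simp add: chord_def)

lemma chord_ge: "0 < p \<Longrightarrow> 0 < q \<Longrightarrow> \<bar>p - q\<bar> \<le> chord p q x"
  unfolding chord_def using chord_arg_ge real_le_rsqrt by (metis abs_le_square_iff power2_abs real_sqrt_abs real_sqrt_le_iff)

lemma chord_eq_imp_cos: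
  assumes "0 < p" "0 < q" "chord p q x = \<bar>p - q\<bar>"
  shows "cos x = 1"
proof -
  have "p\<^sup>2 + q\<^sup>2 - 2 * p * q * cos x = (p - q)\<^sup>2"
    using assms(3) by (metis chord_def real_sqrt_abs real_sqrt_eq_iff)
  then have "p * q * (1 - cos x) = 0"
    by (simp add: power2_diff algebra_simps)
  with assms show ?thesis by simp
qed

lemma chord_minus [simp]: "chord p q (- x) = chord p q x"
  by (simp add: chord_def)

lemma chord_deriv_minus [simp]: "chord_deriv p q (- x) = - chord_deriv p q x"
  by (simp add: chord_deriv_def)

lemma chord_deriv2_minus [simp]: "chord_deriv2 p q (- x) = chord_deriv2 p q x"
  by (simp add: chord_deriv2_def)

lemma chord_commute: "chord p q x = chord q p x"
  by (simp add: chord_def algebra_simps)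

lemma chord_0: "chord p q 0 = \<bar>p - q\<bar>"
proof -
  have "p\<^sup>2 + q\<^sup>2 - 2 * p * q * cos 0 = (p - q)\<^sup>2" by (simp add: power2_diff)
  then show ?thesis unfolding chord_def by (metis real_sqrt_abs)
qed

lemma chord_pi: "chord p q pi = \<bar>p + q\<bar>"
proof -
  have "p\<^sup>2 + q\<^sup>2 - 2 * p * q * cos pi = (p + q)\<^sup>2" by (simp add: power2_sum)
  then show ?thesis unfolding chord_def by (metis real_sqrt_abs)
qed

text \<open>Shifts are needed because at the two triangles the difference \<open>a - b\<close> of
  the polar angles exceeds \<open>pi\<close> in absolute value.\<close>

lemma chord_diff_2pi: "chord p q (x - 2 * pi) = chord p q x"
  by (simp add: chord_def cos_diff)

lemma chord_deriv_diff_2pi: "chord_deriv p q (x - 2 * pi) = chord_deriv p q x"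
  by (simp add: chord_deriv_def chord_diff_2pi sin_diff)

lemma chord_deriv2_diff_2pi: "chord_deriv2 p q (x - 2 * pi) = chord_deriv2 p q x"
  by (simp add: chord_deriv2_def chord_diff_2pi chord_deriv_diff_2pi cos_diff)

lemma has_real_derivative_chord:
  assumes "0 < p" "0 < q" "p \<noteq> q"
  shows "(chord p q has_real_derivative chord_deriv p q x) (at x)"
proof -
  have "((\<lambda>x. p\<^sup>2 + q\<^sup>2 - 2 * p * q * cos x) has_real_derivative 2 * p * q * sin x) (at x)"
    by (auto intro!: derivative_eq_intros)
  note * = DERIV_chain2[OF DERIV_real_sqrt[OF chord_arg_pos[OF assms]] this]
  show ?thesis
    unfolding chord_deriv_def chord_def by (rule DERIV_cong[OF *]) (simp add: field_simps)
qed

lemma has_real_derivative_chord_deriv: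
  assumes "0 < p" "0 < q" "p \<noteq> q"
  shows "(chord_deriv p q has_real_derivative chord_deriv2 p q x) (at x)"
proof -
  have pos: "0 < chord p q x" by (rule chord_pos[OF assms])
  show ?thesis
    unfolding chord_deriv_def[abs_def]
    by (rule derivative_eq_intros has_real_derivative_chord[OF assms] refl)+
      (use pos in \<open>auto simp: chord_deriv2_def chord_deriv_def field_simps power2_eq_square\<close>)
qed

lemma dist_rcis: "dist (rcis p a) (rcis q b) = chord p q (a - b)"
proof -
  have "(p * cos a - q * cos b)\<^sup>2 + (p * sin a - q * sin b)\<^sup>2
      = p\<^sup>2 * ((sin a)\<^sup>2 + (cos a)\<^sup>2) + q\<^sup>2 * ((sin b)\<^sup>2 + (cos b)\<^sup>2) - 2 * p * q * (cos a * cos b + sin a * sin b)"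
    by algebra
  then show ?thesis
    by (simp add: dist_norm cmod_def chord_def cos_diff)
qed

lemma perimeter_polar_circuit:
  "perimeter (polar_circuit r1 r2 r3 (a, b)) = chord r1 r2 (a - b) + chord r2 r3 b + chord r1 r3 a"
proof -
  have "Complex r3 0 = rcis r3 0" by (simp add: rcis_def complex_eq_iff)
  then show ?thesis
    unfolding perimeter_def polar_circuit_def
    \<comment> \<open>The rule \<open>rcis_zero_arg\<close> would turn \<open>rcis r3 0\<close> back
      into a real number and block \<open>dist_rcis\<close>.\<close>
    by (simp add: dist_rcis chord_commute[of r3 r1] del: rcis_zero_arg)
qed

section \<open>Smoothness of the perimeter\<close>

text \<open>A class of smooth functions closed under directional derivatives. The constructor \<open>powr\<close>
  covers both the square root and the reciprocals arising from its derivatives.\<close>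

inductive_set elementary :: "('a::euclidean_space \<Rightarrow> real) set" where
  const: "(\<lambda>_. c) \<in> elementary"
| sin: "bounded_linear l \<Longrightarrow> (\<lambda>x. sin (l x)) \<in> elementary"
| cos: "bounded_linear l \<Longrightarrow> (\<lambda>x. cos (l x)) \<in> elementary"
| add: "f \<in> elementary \<Longrightarrow> g \<in> elementary \<Longrightarrow> (\<lambda>x. f x + g x) \<in> elementary"
| mult: "f \<in> elementary \<Longrightarrow> g \<in> elementary \<Longrightarrow> (\<lambda>x. f x * g x) \<in> elementary"
| powr: "f \<in> elementary \<Longrightarrow> (\<And>x. 0 < f x) \<Longrightarrow> (\<lambda>x. f x powr c) \<in> elementary"

text \<open>Each differentiation rule, read in a fixed direction \<open>v\<close>, only produces
  terms of the same constructors. For \<open>powr\<close> the base stays positive, so the exponent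
  \<open>c - 1\<close> is admissible again.\<close>

lemma elementary_has_derivative:
  assumes "f \<in> elementary"
  shows "\<exists>f'. (\<forall>x. (f has_derivative f' x) (at x)) \<and> (\<forall>v. (\<lambda>x. f' x v) \<in> elementary)"
  using assms
proof induction
  case (const c)
  show ?case
    by (intro exI[of _ "\<lambda>_ _. 0"]) (auto intro: elementary.const)
next
  case (sin l)
  note der = bounded_linear_imp_has_derivative[OF sin]
  show ?case
    by (intro exI[of _ "\<lambda>x v. cos (l x) * l v"] conjI allI)
      (auto intro!: derivative_eq_intros der elementary.intros sin simp: mult.commute)
next
  case (cos l)
  note der = bounded_linear_imp_has_derivative[OF cos]
  show ?case
  proof (intro exI[of _ "\<lambda>x v. sin (l x) * (- l v)"] conjI allI)
    show "((\<lambda>x. cos (l x)) has_derivative (\<lambda>v. sin (l x) * (- l v))) (at x)" for x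
      by (auto intro!: derivative_eq_intros der)
    show "(\<lambda>x. sin (l x) * (- l v)) \<in> elementary" for v
      by (intro elementary.mult elementary.sin elementary.const cos)
  qed
next
  case (add f g)
  then obtain f' g' where "\<forall>x. (f has_derivative f' x) (at x)" "\<forall>v. (\<lambda>x. f' x v) \<in> elementary"
    "\<forall>x. (g has_derivative g' x) (at x)" "\<forall>v. (\<lambda>x. g' x v) \<in> elementary" by blast
  then show ?case
    by (intro exI[of _ "\<lambda>x v. f' x v + g' x v"])
      (auto intro!: has_derivative_add elementary.add)
next
  case (mult f g)
  then obtain f' g' where "\<forall>x. (f has_derivative f' x) (at x)" "\<forall>v. (\<lambda>x. f' x v) \<in> elementary"
    "\<forall>x. (g has_derivative g' x) (at x)" "\<forall>v. (\<lambda>x. g' x v) \<in> elementary" by blast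
  with mult show ?case
    by (intro exI[of _ "\<lambda>x v. f x * g' x v + f' x v * g x"])
      (auto intro!: has_derivative_mult elementary.add elementary.mult)
next
  case (powr f c)
  then obtain f' where f': "\<forall>x. (f has_derivative f' x) (at x)" "\<forall>v. (\<lambda>x. f' x v) \<in> elementary"
    by blast
  have "((\<lambda>x. f x powr c) has_derivative (\<lambda>v. (c * f x powr (c - 1)) * f' x v)) (at x)" for x
  proof -
    have "((\<lambda>y. y powr c) has_real_derivative c * f x powr (c - 1)) (at (f x))"
      using powr.hyps(2)[of x] by (rule has_real_derivative_powr)
    then have *: "((\<lambda>y. y powr c) has_derivative (\<lambda>h. (c * f x powr (c - 1)) * h)) (at (f x))"
      by (simp add: has_field_derivative_def)
    show ?thesis
      using diff_chain_at[OF f'(1)[rule_format] *] by (simp add: o_def)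
  qed
  with f'(2) powr.hyps show ?case
    by (intro exI[of _ "\<lambda>x v. (c * f x powr (c - 1)) * f' x v"])
      (auto intro!: elementary.const elementary.mult elementary.powr)
qed

text \<open>Induction on the order with \<open>f\<close> arbitrary: a directional derivative is
  again elementary, so the induction hypothesis covers it.\<close>

lemma elementary_smooth:
  assumes "f \<in> elementary"
  shows "smooth f"
proof -
  have "continuously_differentiable n f" for n
    using assms
  proof (induction n arbitrary: f)
    case 0
    then show ?case
      using elementary_has_derivative[OF 0]
      by (auto intro!: continuous_at_imp_continuous_on dest: has_derivative_continuous)
  next
    case (Suc n)
    obtain f' where f': "\<And>x. (f has_derivative f' x) (at x)" "\<And>v. (\<lambda>x. f' x v) \<in> elementary"
      using elementary_has_derivative[OF Suc.prems] by blast
    have "frechet_derivative f (at x) = f' x" for x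
      using frechet_derivative_at[OF f'(1)] by simp
    with f' Suc.IH show ?case
      by (auto simp: differentiable_def)
  qed
  then show ?thesis by (simp add: smooth_def)
qed

text \<open>Distinct radii keep the radicand strictly positive, so the square root may be written as
  a power with exponent \<open>1/2\<close>.\<close>

lemma chord_elementary:
  assumes "bounded_linear l" "0 < p" "0 < q" "p \<noteq> q"
  shows "(\<lambda>x. chord p q (l x)) \<in> elementary"
proof -
  have "(\<lambda>x. ((p\<^sup>2 + q\<^sup>2) + (- (2 * p * q)) * cos (l x)) powr (1/2)) \<in> elementary"
    using chord_arg_pos[OF assms(2-)] assms(1)
    by (intro elementary.powr elementary.add elementary.mult elementary.const elementary.cos) auto
  moreover have "(\<lambda>x. chord p q (l x)) = (\<lambda>x. ((p\<^sup>2 + q\<^sup>2) + (- (2 * p * q)) * cos (l x)) powr (1/2))"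
    using chord_arg_pos[OF assms(2-)] by (auto simp: chord_def powr_half_sqrt less_imp_le)
  ultimately show ?thesis by simp
qed

lemma perimeter_comp_polar_circuit:
  "perimeter \<circ> polar_circuit r1 r2 r3 =
     (\<lambda>\<theta>. chord r1 r2 (fst \<theta> - snd \<theta>) + chord r2 r3 (snd \<theta>) + chord r1 r3 (fst \<theta>))"
proof
  fix \<theta> :: "real \<times> real"
  show "(perimeter \<circ> polar_circuit r1 r2 r3) \<theta> =
      chord r1 r2 (fst \<theta> - snd \<theta>) + chord r2 r3 (snd \<theta>) + chord r1 r3 (fst \<theta>)"
    using perimeter_polar_circuit[of r1 r2 r3 "fst \<theta>" "snd \<theta>"] by simp
qed

lemma bounded_linear_fst_minus_snd: "bounded_linear (\<lambda>\<theta>::real \<times> real. fst \<theta> - snd \<theta>)"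
  by (rule bounded_linear_sub[OF bounded_linear_fst bounded_linear_snd])

lemma smooth_perimeter:
  assumes "0 < r1" "r1 < r2" "r2 < r3"
  shows "smooth (perimeter \<circ> polar_circuit r1 r2 r3)"
proof -
  have "r1 \<noteq> r2" "r2 \<noteq> r3" "r1 \<noteq> r3" "0 < r2" "0 < r3" using assms by auto
  note el = chord_elementary[OF bounded_linear_fst_minus_snd \<open>0 < r1\<close> \<open>0 < r2\<close> \<open>r1 \<noteq> r2\<close>]
    chord_elementary[OF bounded_linear_snd \<open>0 < r2\<close> \<open>0 < r3\<close> \<open>r2 \<noteq> r3\<close>]
    chord_elementary[OF bounded_linear_fst \<open>0 < r1\<close> \<open>0 < r3\<close> \<open>r1 \<noteq> r3\<close>]
  show ?thesis
    unfolding perimeter_comp_polar_circuit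
    by (rule elementary_smooth[OF elementary.add[OF elementary.add[OF el(1,2)] el(3)]])
qed

section \<open>First and second derivatives of the perimeter in polar angles\<close>

definition perimeter_deriv :: "real \<Rightarrow> real \<Rightarrow> real \<Rightarrow> real \<times> real \<Rightarrow> real \<times> real \<Rightarrow> real" where
  "perimeter_deriv r1 r2 r3 \<theta> u =
     chord_deriv r1 r2 (fst \<theta> - snd \<theta>) * (fst u - snd u) + chord_deriv r2 r3 (snd \<theta>) * snd u
       + chord_deriv r1 r3 (fst \<theta>) * fst u"

lemma has_derivative_compose_real:
  assumes "(f has_real_derivative d) (at (l x))" "bounded_linear l"
  shows "((\<lambda>x. f (l x)) has_derivative (\<lambda>v. d * l v)) (at x)"
  using diff_chain_at[OF bounded_linear_imp_has_derivative[OF assms(2)] assms(1)[unfolded has_field_derivative_def]]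
  unfolding o_def .

lemma has_derivative_perimeter:
  assumes "0 < r1" "r1 < r2" "r2 < r3"
  shows "((perimeter \<circ> polar_circuit r1 r2 r3) has_derivative perimeter_deriv r1 r2 r3 \<theta>) (at \<theta>)"
proof -
  have "r1 \<noteq> r2" "r2 \<noteq> r3" "r1 \<noteq> r3" "0 < r2" "0 < r3" using assms by auto
  note hd = has_real_derivative_chord[OF \<open>0 < r1\<close> \<open>0 < r2\<close> \<open>r1 \<noteq> r2\<close>]
    has_real_derivative_chord[OF \<open>0 < r2\<close> \<open>0 < r3\<close> \<open>r2 \<noteq> r3\<close>]
    has_real_derivative_chord[OF \<open>0 < r1\<close> \<open>0 < r3\<close> \<open>r1 \<noteq> r3\<close>]
  show ?thesis
    unfolding perimeter_comp_polar_circuit perimeter_deriv_def[abs_def]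
    by (intro has_derivative_add has_derivative_compose_real[OF hd(1) bounded_linear_fst_minus_snd]
        has_derivative_compose_real[OF hd(2) bounded_linear_snd]
        has_derivative_compose_real[OF hd(3) bounded_linear_fst])
qed

lemma has_derivative_perimeter_deriv:
  assumes "0 < r1" "r1 < r2" "r2 < r3"
  shows "((\<lambda>\<theta>. perimeter_deriv r1 r2 r3 \<theta> u) has_derivative
    (\<lambda>v. chord_deriv2 r1 r2 (fst \<theta> - snd \<theta>) * (fst v - snd v) * (fst u - snd u)
      + chord_deriv2 r2 r3 (snd \<theta>) * snd v * snd u + chord_deriv2 r1 r3 (fst \<theta>) * fst v * fst u)) (at \<theta>)"
proof -
  have "r1 \<noteq> r2" "r2 \<noteq> r3" "r1 \<noteq> r3" "0 < r2" "0 < r3" using assms by auto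
  note hd = has_real_derivative_chord_deriv[OF \<open>0 < r1\<close> \<open>0 < r2\<close> \<open>r1 \<noteq> r2\<close>]
    has_real_derivative_chord_deriv[OF \<open>0 < r2\<close> \<open>0 < r3\<close> \<open>r2 \<noteq> r3\<close>]
    has_real_derivative_chord_deriv[OF \<open>0 < r1\<close> \<open>0 < r3\<close> \<open>r1 \<noteq> r3\<close>]
  show ?thesis
    unfolding perimeter_deriv_def
    by (intro has_derivative_add has_derivative_mult_left
        has_derivative_compose_real[OF hd(1) bounded_linear_fst_minus_snd]
        has_derivative_compose_real[OF hd(2) bounded_linear_snd]
        has_derivative_compose_real[OF hd(3) bounded_linear_fst])
qed

lemma hessian_perimeter:
  assumes "0 < r1" "r1 < r2" "r2 < r3"
  shows "hessian (perimeter \<circ> polar_circuit r1 r2 r3) \<theta> u v =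
      chord_deriv2 r1 r2 (fst \<theta> - snd \<theta>) * (fst v - snd v) * (fst u - snd u)
      + chord_deriv2 r2 r3 (snd \<theta>) * snd v * snd u + chord_deriv2 r1 r3 (fst \<theta>) * fst v * fst u"
  unfolding hessian_def frechet_derivative_at[OF has_derivative_perimeter[OF assms], symmetric]
    frechet_derivative_at[OF has_derivative_perimeter_deriv[OF assms], symmetric]
  by (rule refl)

text \<open>The two partial derivatives are read off at the basis vectors. Since
  \<open>chord_deriv\<close> is odd, their vanishing says that the signed distance is the same at
  the oriented central angles \<open>a - b\<close>, \<open>b\<close> and \<open>- a\<close>.\<close>

lemma critical_point_perimeter_iff:
  assumes "0 < r1" "r1 < r2" "r2 < r3"
  shows "critical_point (perimeter \<circ> polar_circuit r1 r2 r3) (a, b) \<longleftrightarrow>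
    chord_deriv r2 r3 b = chord_deriv r1 r2 (a - b) \<and>
    chord_deriv r1 r3 a = - chord_deriv r1 r2 (a - b)" (is "?L \<longleftrightarrow> ?R")
proof
  assume ?L
  then have "perimeter_deriv r1 r2 r3 (a, b) = (\<lambda>_. 0)"
    unfolding critical_point_def
    by (rule has_derivative_unique[OF has_derivative_perimeter[OF assms]])
  then have "perimeter_deriv r1 r2 r3 (a, b) (1, 0) = 0" "perimeter_deriv r1 r2 r3 (a, b) (0, 1) = 0"
    by auto
  then show ?R by (simp add: perimeter_deriv_def)
next
  assume ?R
  then have "perimeter_deriv r1 r2 r3 (a, b) = (\<lambda>_. 0)"
    by (auto simp: perimeter_deriv_def algebra_simps)
  then show ?L
    unfolding critical_point_def using has_derivative_perimeter[OF assms] by metis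
qed

section \<open>Binary quadratic forms: nondegeneracy and Morse index\<close>

text \<open>Testing against the basis vectors gives a homogeneous linear system with determinant
  \<open>p * s - q\<^sup>2\<close>; Cramer's rule leaves only the zero solution.\<close>

lemma binary_form_nondegenerate:
  fixes p q s :: real
  assumes "p * s \<noteq> q\<^sup>2"
    and H: "\<And>u v. hessian f x u v = p * fst u * fst v + q * (fst u * snd v + snd u * fst v) + s * snd u * snd v"
    and "critical_point f x"
  shows "nondegenerate_critical_point f x"
  unfolding nondegenerate_critical_point_def
proof (intro conjI allI impI assms(3))
  fix u assume "\<forall>v. hessian f x u v = 0"
  then have "hessian f x u (1, 0) = 0" "hessian f x u (0, 1) = 0" by auto
  then have "p * fst u + q * snd u = 0" "q * fst u + s * snd u = 0" by (auto simp: H algebra_simps)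
  then have "(p * s - q\<^sup>2) * fst u = 0" "(p * s - q\<^sup>2) * snd u = 0" by algebra+
  with assms(1) show "u = 0" by (auto simp: prod_eq_iff)
qed

lemma binary_form_neg:
  fixes p q s :: real
  assumes "p * s < q\<^sup>2"
  shows "\<exists>v w. p * v * v + 2 * q * v * w + s * w * w < 0"
proof -
  consider "p < 0" | "p > 0" | "p = 0" by linarith
  then show ?thesis
  proof cases
    case 1 then show ?thesis by (intro exI[of _ 1] exI[of _ 0]) auto
  next
    case 2
    have "p * (p * s - q\<^sup>2) < 0" using 2 assms by (simp add: mult_pos_neg)
    \<comment> \<open>The vector \<open>(-q, p)\<close> is orthogonal to \<open>(1, 0)\<close> with
      respect to the form, and the form takes the value \<open>p * (p * s - q\<^sup>2)\<close>
      there.\<close>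
    then show ?thesis by (intro exI[of _ "-q"] exI[of _ p]) (simp add: algebra_simps power2_eq_square)
  next
    case 3
    with assms have "q \<noteq> 0" by auto
    \<comment> \<open>With \<open>p = 0\<close> and \<open>w = 1\<close> the form is affine in
      \<open>v\<close>; this \<open>v\<close> makes its value \<open>-1\<close>.\<close>
    with 3 show ?thesis by (intro exI[of _ "-(s + 1) / (2 * q)"] exI[of _ 1]) (simp add: field_simps)
  qed
qed

text \<open>A form with negative determinant takes both signs. A negative vector spans a line on
  which it is negative definite, and a positive vector prevents this on the whole plane.\<close>

lemma binary_form_morse_index:
  fixes f :: "real \<times> real \<Rightarrow> real" and p q s :: real
  assumes "p * s < q\<^sup>2"
    and H: "\<And>u v. hessian f x u v = p * fst u * fst v + q * (fst u * snd v + snd u * fst v) + s * snd u * snd v"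
  shows "morse_index f x = 1"
proof -
  let ?neg = "\<lambda>V. \<forall>v\<in>V. v \<noteq> 0 \<longrightarrow> hessian f x v v < 0"
  let ?D = "{dim V | V. subspace V \<and> ?neg V}"
  have D2: "DIM(real \<times> real) = 2" by simp
  obtain v1 v2 where v: "p * v1 * v1 + 2 * q * v1 * v2 + s * v2 * v2 < 0"
    using binary_form_neg[OF assms(1)] by blast
  \<comment> \<open>The negated form has the same determinant, so it takes a negative value too;
    this yields a positive vector of the original form.\<close>
  have "\<exists>v w. (-p) * v * v + 2 * (-q) * v * w + (-s) * w * w < 0"
    using assms(1) by (intro binary_form_neg) simp
  then obtain w1 w2 where w: "p * w1 * w1 + 2 * q * w1 * w2 + s * w2 * w2 > 0"
    by (smt (verit) mult_minus_left mult_minus_right)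
  have le: "d \<le> 1" if d: "d \<in> ?D" for d
  proof (rule ccontr)
    assume "\<not> d \<le> 1"
    obtain V where V: "d = dim V" "subspace V" "?neg V" using d by blast
    have "dim V \<le> 2" using dim_subset_UNIV[of V] D2 by simp
    with \<open>\<not> d \<le> 1\<close> V(1) have "dim V = DIM(real \<times> real)" by simp
    then have "span V = UNIV" by (simp only: dim_eq_full)
    with V(2) have "V = UNIV" by (metis span_eq_iff)
    with V(3) w have "hessian f x (w1, w2) (w1, w2) < 0"
      by (cases "(w1, w2) = 0") (auto simp: zero_prod_def)
    with w show False by (simp add: H algebra_simps)
  qed
  have "1 \<in> ?D"
  proof -
    let ?v = "(v1, v2)"
    have nz: "?v \<noteq> 0" using v by (auto simp: zero_prod_def)
    have "?neg (span {?v})"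
    proof (intro ballI impI)
      fix y assume "y \<in> span {?v}" "y \<noteq> 0"
      then obtain k where k: "y = k *\<^sub>R ?v" by (auto simp: span_singleton)
      with \<open>y \<noteq> 0\<close> have "k \<noteq> 0" by (metis scale_zero_left)
      then have "k * k > 0" by (metis not_real_square_gt_zero)
      moreover have "hessian f x y y = k * k * (p * v1 * v1 + 2 * q * v1 * v2 + s * v2 * v2)"
        by (simp add: H k algebra_simps)
      ultimately show "hessian f x y y < 0" using v by (simp only: mult_pos_neg)
    qed
    moreover have "dim (span {?v}) = 1" using nz by simp
    ultimately show ?thesis by (smt (verit) mem_Collect_eq subspace_span)
  qed
  moreover have "finite ?D" using le by (intro finite_subset[of ?D "{..1}"]) auto
  ultimately show ?thesis
    unfolding morse_index_def using le by (intro Max_eqI) auto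
qed

text \<open>Writing \<open>A\<close>, \<open>B\<close>, \<open>C\<close> for the second derivatives
  of the three sides, the matrix has diagonal \<open>A + C\<close>, \<open>A + B\<close> and
  off-diagonal entry \<open>- A\<close>; its determinant is
  \<open>A * B + B * C + C * A\<close>.\<close>

lemma hessian_perimeter_form:
  assumes "0 < r1" "r1 < r2" "r2 < r3"
  shows "hessian (perimeter \<circ> polar_circuit r1 r2 r3) (a, b) u v =
      (chord_deriv2 r1 r2 (a - b) + chord_deriv2 r1 r3 a) * fst u * fst v
      + (- chord_deriv2 r1 r2 (a - b)) * (fst u * snd v + snd u * fst v)
      + (chord_deriv2 r1 r2 (a - b) + chord_deriv2 r2 r3 b) * snd u * snd v"
  by (simp add: hessian_perimeter[OF assms] algebra_simps)

section \<open>Triangles with the origin as incentre\<close>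

text \<open>\<beta> and \<gamma> are the base angles of the triangle formed by the origin and the
  chord. The perpendicular from the origin to the chord has length \<open>chord_deriv p q x\<close>,
  which gives both sines.\<close>

lemma law_of_sines:
  assumes "0 < p" "0 < q" "p \<noteq> q" "0 < x" "x < pi"
  obtains \<beta> \<gamma> where "0 < \<beta>" "0 < \<gamma>" "\<beta> + \<gamma> + x = pi"
    "sin \<beta> = chord_deriv p q x / p" "sin \<gamma> = chord_deriv p q x / q"
proof -
  define D where "D = chord p q x"
  have D: "0 < D" using chord_pos[OF assms(1-3)] by (simp add: D_def)
  have sx: "0 < sin x" using assms by (simp add: sin_gt_zero)
  have D2: "D\<^sup>2 = (p - q * cos x)\<^sup>2 + (q * sin x)\<^sup>2"
  proof -
    have "D\<^sup>2 = p\<^sup>2 + q\<^sup>2 - 2 * p * q * cos x"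
      unfolding D_def chord_def using chord_arg_pos[OF assms(1-3), of x] by simp
    also have "\<dots> = (p - q * cos x)\<^sup>2 + (q * sin x)\<^sup>2"
      using sin_cos_squared_add[of x] by algebra
    finally show ?thesis .
  qed
  then have "((p - q * cos x) / D)\<^sup>2 + (q * sin x / D)\<^sup>2 = 1"
    using D by (metis D2 add_divide_distrib divide_self power_divide power_not_zero order_less_irrefl)
  moreover have pos: "0 < q * sin x / D" using assms sx D by simp
  \<comment> \<open>The base angle is recovered from its cosine and sine together, so an obtuse
    \<beta> is covered as well.\<close>
  ultimately obtain \<beta> where \<beta>: "0 \<le> \<beta>" "\<beta> \<le> pi" "(p - q * cos x) / D = cos \<beta>" "q * sin x / D = sin \<beta>"
    using sincos_total_pi[of "q * sin x / D" "(p - q * cos x) / D"] by auto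
  have "0 < \<beta>" "\<beta> < pi" using \<beta> pos by (metis less_eq_real_def sin_zero sin_pi order_less_irrefl)+
  define \<gamma> where "\<gamma> = pi - x - \<beta>"
  have "sin \<gamma> = sin x * cos \<beta> + cos x * sin \<beta>"
    by (simp add: \<gamma>_def sin_diff sin_add cos_diff)
  also have "\<dots> = p * sin x / D"
    using D by (simp add: \<beta>(3,4)[symmetric] field_simps)
  finally have s\<gamma>: "sin \<gamma> = p * sin x / D" .
  \<comment> \<open>Both \<open>x\<close> and \<beta> are below \<open>pi\<close>, hence
    \<open>\<gamma> > - pi\<close>; a nonpositive \<gamma> would then have a nonpositive
    sine.\<close>
  have "0 < \<gamma>"
  proof (rule ccontr)
    assume "\<not> 0 < \<gamma>"
    then have "0 \<le> sin (- \<gamma>)"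
      using assms \<open>\<beta> < pi\<close> by (intro sin_ge_zero) (auto simp: \<gamma>_def)
    moreover have "0 < sin \<gamma>" using s\<gamma> assms sx D by simp
    ultimately show False by simp
  qed
  show ?thesis
  proof (rule that[OF \<open>0 < \<beta>\<close> \<open>0 < \<gamma>\<close>])
    show "\<beta> + \<gamma> + x = pi" by (simp add: \<gamma>_def)
    show "sin \<beta> = chord_deriv p q x / p" "sin \<gamma> = chord_deriv p q x / q"
      using assms by (simp_all add: \<beta>(4)[symmetric] s\<gamma> chord_deriv_def D_def)
  qed
qed

text \<open>Equal sines leave equal or supplementary angles. The bound on the sum excludes the
  latter, and two equal angles below that bound are acute, hence on the principal branch of
  \<open>arcsin\<close>.\<close>

lemma sin_eq_arcsin:
  assumes "sin \<beta> = s" "sin \<gamma> = s" "0 < \<beta>" "0 < \<gamma>" "\<beta> + \<gamma> < pi"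
  shows "\<beta> = arcsin s" "\<gamma> = arcsin s"
proof -
  have "\<beta> = \<gamma>"
  proof -
    have "sin ((\<beta> - \<gamma>) / 2) * cos ((\<beta> + \<gamma>) / 2) = 0"
      using sin_diff_sin[of \<beta> \<gamma>] assms by simp
    moreover have "cos ((\<beta> + \<gamma>) / 2) > 0" using assms by (intro cos_gt_zero_pi) auto
    ultimately have "sin ((\<beta> - \<gamma>) / 2) = 0" by simp
    then show ?thesis using sin_eq_0_pi[of "(\<beta> - \<gamma>) / 2"] assms by auto
  qed
  with assms show "\<beta> = arcsin s" "\<gamma> = arcsin s" by (auto simp: arcsin_sin[symmetric] intro!: arcsin_sin[symmetric])
qed

text \<open>The six angles between the sides and the radii add up to \<open>\<pi>\<close>, and the two at \<open>p\<^sub>i\<close> have the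
  same sine \<open>d / r\<^sub>i\<close>; they cannot be supplementary, so they are equal.\<close>

lemma equal_chord_deriv_imp_incentre:
  assumes r: "0 < r1" "r1 < r2" "r2 < r3"
    and x: "0 < x" "x < pi" and y: "0 < y" "y < pi" and z: "0 < z" "z < pi"
    and sum: "x + y + z = 2 * pi"
    and d: "chord_deriv r1 r2 x = d" "chord_deriv r2 r3 y = d" "chord_deriv r1 r3 z = d"
  shows "x = pi / 2 + arcsin (d / r3)" "y = pi / 2 + arcsin (d / r1)" "z = pi / 2 + arcsin (d / r2)"
    "arcsin (d / r1) + arcsin (d / r2) + arcsin (d / r3) = pi / 2" "d < r1"
proof -
  obtain x1 x2 where X: "0 < x1" "0 < x2" "x1 + x2 + x = pi" "sin x1 = d / r1" "sin x2 = d / r2"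
    using law_of_sines[of r1 r2 x] r x d by (metis less_trans less_irrefl)
  obtain y2 y3 where Y: "0 < y2" "0 < y3" "y2 + y3 + y = pi" "sin y2 = d / r2" "sin y3 = d / r3"
    using law_of_sines[of r2 r3 y] r y d by (metis less_trans less_irrefl)
  obtain z1 z3 where Z: "0 < z1" "0 < z3" "z1 + z3 + z = pi" "sin z1 = d / r1" "sin z3 = d / r3"
    using law_of_sines[of r1 r3 z] r z d by (metis less_trans less_irrefl)
  have tot: "(x1 + z1) + (x2 + y2) + (y3 + z3) = pi" using X Y Z sum by linarith
  have X1: "x1 = arcsin (d / r1)" "z1 = arcsin (d / r1)"
    using sin_eq_arcsin[of x1 "d / r1" z1] X Y Z tot by auto
  moreover have "x2 = arcsin (d / r2)" "y2 = arcsin (d / r2)"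
    using sin_eq_arcsin[of x2 "d / r2" y2] X Y Z tot by auto
  moreover have "y3 = arcsin (d / r3)" "z3 = arcsin (d / r3)"
    using sin_eq_arcsin[of y3 "d / r3" z3] X Y Z tot by auto
  ultimately show "x = pi / 2 + arcsin (d / r3)" "y = pi / 2 + arcsin (d / r1)" "z = pi / 2 + arcsin (d / r2)"
    "arcsin (d / r1) + arcsin (d / r2) + arcsin (d / r3) = pi / 2"
    using X(3) Y(3) Z(3) tot by linarith+
  \<comment> \<open>The two equal angles at the first vertex add up to less than \<open>pi\<close>,
    so each is strictly acute and its sine \<open>d / r1\<close> is below 1.\<close>
  have "x1 = z1" using X1 by simp
  then have "x1 < pi / 2" using tot X Y Z by linarith
  then have "sin x1 < sin (pi / 2)" using X(1) by (intro sin_monotone_2pi) auto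
  then show "d < r1" using X(4) r by simp
qed

text \<open>The perpendicular of length \<open>t\<close> from the origin splits the side into
  \<open>t * cot \<alpha>\<close> and \<open>t * cot \<beta>\<close>, while the endpoints lie at
  distances \<open>t / sin \<alpha>\<close> and \<open>t / sin \<beta>\<close>.\<close>

lemma chord_at_incentre:
  assumes "0 < \<alpha>" "\<alpha> < pi / 2" "0 < \<beta>" "\<beta> < pi / 2" "0 < t"
  shows "chord (t / sin \<alpha>) (t / sin \<beta>) (pi - \<alpha> - \<beta>) = t * (cot \<alpha> + cot \<beta>)"
    and "chord_deriv (t / sin \<alpha>) (t / sin \<beta>) (pi - \<alpha> - \<beta>) = t"
proof -
  have s: "0 < sin \<alpha>" "0 < sin \<beta>" and c: "0 < cos \<alpha>" "0 < cos \<beta>"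
    using assms by (auto intro: sin_gt_zero cos_gt_zero)
  have cc: "cos (pi - \<alpha> - \<beta>) = sin \<alpha> * sin \<beta> - cos \<alpha> * cos \<beta>"    by (simp add: cos_diff sin_diff)
  have one: "1 / (sin \<gamma>)\<^sup>2 = 1 + (cot \<gamma>)\<^sup>2" if "0 < sin \<gamma>" for \<gamma> :: real
    using that sin_cos_squared_add[of \<gamma>] by (simp add: cot_def field_simps)
  have "(t / sin \<alpha>)\<^sup>2 + (t / sin \<beta>)\<^sup>2 - 2 * (t / sin \<alpha>) * (t / sin \<beta>) * cos (pi - \<alpha> - \<beta>)
      = t\<^sup>2 * (1 / (sin \<alpha>)\<^sup>2) + t\<^sup>2 * (1 / (sin \<beta>)\<^sup>2) - 2 * t\<^sup>2 * (1 - cot \<alpha> * cot \<beta>)"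
    using s unfolding cc by (simp add: cot_def field_simps power2_eq_square)
  also have "\<dots> = (t * (cot \<alpha> + cot \<beta>))\<^sup>2"
    unfolding one[OF s(1)] one[OF s(2)] by algebra
  finally show chord: "chord (t / sin \<alpha>) (t / sin \<beta>) (pi - \<alpha> - \<beta>) = t * (cot \<alpha> + cot \<beta>)"
    using s c assms by (simp add: chord_def cot_def)
  have p: "0 < cos \<alpha> * sin \<beta> + cos \<beta> * sin \<alpha>"
    using s c by (simp add: add_pos_pos)
  have sum: "cot \<alpha> + cot \<beta> = (cos \<alpha> * sin \<beta> + cos \<beta> * sin \<alpha>) / (sin \<alpha> * sin \<beta>)"
    using s by (simp add: cot_def field_simps)
  have ss: "sin (pi - \<alpha> - \<beta>) = cos \<alpha> * sin \<beta> + cos \<beta> * sin \<alpha>"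
    by (simp add: sin_diff cos_diff)
  show "chord_deriv (t / sin \<alpha>) (t / sin \<beta>) (pi - \<alpha> - \<beta>) = t"
    unfolding chord_deriv_def chord ss sum using p s assms(5) by simp
qed

section \<open>The cubic equation of the inradius\<close>

text \<open>Sines \<open>u\<close>, \<open>v\<close>, \<open>w\<close> of three angles with sum
  \<open>pi / 2\<close> satisfy
  \<open>u\<^sup>2 + v\<^sup>2 + w\<^sup>2 + 2 * u * v * w = 1\<close>. With
  \<open>u = d / r1\<close> and so on, clearing denominators gives the cubic.\<close>

lemma incircle_cubic:
  fixes r1 r2 r3 d :: real
  assumes "0 < d" "d < r1" "r1 < r2" "r2 < r3"
    and "arcsin (d / r1) + arcsin (d / r2) + arcsin (d / r3) = pi / 2"
  shows "2 * r1 * r2 * r3 * d ^ 3 + (r1\<^sup>2 * r2\<^sup>2 + r2\<^sup>2 * r3\<^sup>2 + r3\<^sup>2 * r1\<^sup>2) * d\<^sup>2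
              - r1\<^sup>2 * r2\<^sup>2 * r3\<^sup>2 = 0"
proof -
  have bd: "\<bar>d / r1\<bar> \<le> 1" "\<bar>d / r2\<bar> \<le> 1" "\<bar>d / r3\<bar> \<le> 1" using assms by (auto simp: field_simps)
  let ?u = "d / r1" and ?v = "d / r2" and ?w = "d / r3"
  have "?w = sin (pi / 2 - (arcsin ?u + arcsin ?v))"
    using assms(5) bd by (metis add_diff_cancel_left' abs_le_iff minus_le_iff sin_arcsin)
  also have "\<dots> = cos (arcsin ?u) * cos (arcsin ?v) - ?u * ?v"
  proof -
    have "sin (arcsin ?u) = ?u" "sin (arcsin ?v) = ?v"
      using bd by (simp_all only: sin_arcsin abs_le_iff minus_le_iff)
    then show ?thesis by (simp add: sin_diff cos_add)
  qed
  \<comment> \<open>Squaring turns the product of cosines into a polynomial in the sines.\<close>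
  finally have "(?w + ?u * ?v)\<^sup>2 = (cos (arcsin ?u))\<^sup>2 * (cos (arcsin ?v))\<^sup>2"
    by (metis diff_add_cancel power_mult_distrib)
  also have "\<dots> = (1 - ?u\<^sup>2) * (1 - ?v\<^sup>2)"
  proof -
    have "sin (arcsin ?u) = ?u" "sin (arcsin ?v) = ?v"
      using bd by (simp_all only: sin_arcsin abs_le_iff minus_le_iff)
    then show ?thesis by (simp only: cos_squared_eq)
  qed
  finally have *: "2 * ?u * ?v * ?w + ?u\<^sup>2 + ?v\<^sup>2 + ?w\<^sup>2 - 1 = 0" by algebra
  have "2 * r1 * r2 * r3 * d ^ 3 + (r1\<^sup>2 * r2\<^sup>2 + r2\<^sup>2 * r3\<^sup>2 + r3\<^sup>2 * r1\<^sup>2) * d\<^sup>2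
              - r1\<^sup>2 * r2\<^sup>2 * r3\<^sup>2 = r1\<^sup>2 * r2\<^sup>2 * r3\<^sup>2 * (2 * u * v * w + u\<^sup>2 + v\<^sup>2 + w\<^sup>2 - 1)"
    if "d = u * r1" "d = v * r2" "d = w * r3" for u v w
    using that by algebra
  from this[of ?u ?v ?w] * assms(1-4) show ?thesis by simp
qed

text \<open>The cubic is strictly increasing for positive arguments: the difference of its values at
  \<open>s\<close> and \<open>t\<close> is \<open>s - t\<close> times a positive factor.\<close>

lemma incircle_cubic_unique:
  fixes r1 r2 r3 s t :: real
  assumes "0 < r1" "0 < r2" "0 < r3" "0 < s" "0 < t"
    and "2 * r1 * r2 * r3 * s ^ 3 + (r1\<^sup>2 * r2\<^sup>2 + r2\<^sup>2 * r3\<^sup>2 + r3\<^sup>2 * r1\<^sup>2) * s\<^sup>2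
              - r1\<^sup>2 * r2\<^sup>2 * r3\<^sup>2 = 0"
    and "2 * r1 * r2 * r3 * t ^ 3 + (r1\<^sup>2 * r2\<^sup>2 + r2\<^sup>2 * r3\<^sup>2 + r3\<^sup>2 * r1\<^sup>2) * t\<^sup>2
              - r1\<^sup>2 * r2\<^sup>2 * r3\<^sup>2 = 0"
  shows "s = t"
proof -
  define p q where "p = 2 * r1 * r2 * r3" and "q = r1\<^sup>2 * r2\<^sup>2 + r2\<^sup>2 * r3\<^sup>2 + r3\<^sup>2 * r1\<^sup>2"
  have pq: "0 < p" "0 < q" using assms by (auto simp: p_def q_def intro!: add_pos_pos)
  have "p * s ^ 3 + q * s\<^sup>2 = p * t ^ 3 + q * t\<^sup>2" using assms unfolding p_def q_def by linarith
  then have "(s - t) * (p * (s\<^sup>2 + s * t + t\<^sup>2) + q * (s + t)) = 0" by algebra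
  moreover have "0 < p * (s\<^sup>2 + s * t + t\<^sup>2) + q * (s + t)"
    using pq assms by (auto intro!: add_pos_pos mult_pos_pos)
  ultimately show ?thesis by auto
qed

text \<open>Intermediate value theorem: the sum of arcsines vanishes at 0, and at \<open>r1\<close>
  its first term alone is already \<open>pi / 2\<close>.\<close>

lemma incircle_radius_exists:
  fixes r1 r2 r3 :: real
  assumes "0 < r1" "r1 < r2" "r2 < r3"
  obtains t where "0 < t" "t < r1" "arcsin (t / r1) + arcsin (t / r2) + arcsin (t / r3) = pi / 2"
proof -
  let ?f = "\<lambda>t. arcsin (t / r1) + arcsin (t / r2) + arcsin (t / r3)"
  have pos: "0 < arcsin (r1 / r2)" "0 < arcsin (r1 / r3)"
    using assms arcsin_less_arcsin[of 0] by auto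
  have "continuous_on {0..r1} ?f"
    using assms by (intro continuous_intros ballI conjI) (auto simp: field_simps)
  moreover have "?f 0 \<le> pi / 2" "pi / 2 \<le> ?f r1" using assms pos by auto
  ultimately obtain t where t: "0 \<le> t" "t \<le> r1" "?f t = pi / 2"
    using IVT'[of ?f 0 "pi/2" r1] assms by auto
  have "t \<noteq> 0" "t \<noteq> r1" using t(3) pos assms by auto
  then show ?thesis using t by (intro that[of t]) auto
qed

section \<open>Sides of the triangle and comparison with the longest parade\<close>

text \<open>In the addition formula the numerator is positive and the denominator
  \<open>1 - tan u * tan v\<close> lies strictly between 0 and 1.\<close>

lemma tan_superadditive:
  fixes u v :: real
  assumes "0 < u" "0 < v" "u + v < pi / 2"
  shows "tan u + tan v < tan (u + v)"
proof -
  have c: "0 < cos u" "0 < cos v" "0 < cos (u + v)" using assms by (auto intro: cos_gt_zero)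
  have t: "0 < tan u" "0 < tan v" using assms by (auto intro: tan_gt_zero)
  have "0 < 1 - tan u * tan v"
  proof -
    have "1 - tan u * tan v = cos (u + v) / (cos u * cos v)"
      using c by (simp add: tan_def cos_add field_simps)
    then show ?thesis using c by simp
  qed
  then have "(tan u + tan v) * (1 - tan u * tan v) < (tan u + tan v) * 1" "0 < 1 - tan u * tan v"
    using t by (intro mult_strict_left_mono, auto)
  moreover have "tan (u + v) = (tan u + tan v) / (1 - tan u * tan v)"
    using c by (intro tan_add) auto
  ultimately show ?thesis by (simp only: pos_less_divide_eq) simp
qed


lemma arcsin_quotient_bounds:
  assumes "0 < t" "t < p"
  shows "0 < arcsin (t / p)" "arcsin (t / p) < pi / 2"
proof -
  have b: "-1 \<le> t / p" "t / p < 1" "0 < t / p" using assms by (auto simp: field_simps)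
  show "0 < arcsin (t / p)" using arcsin_less_arcsin[of 0 "t / p"] b by simp
  show "arcsin (t / p) < pi / 2" using arcsin_less_arcsin[OF b(1,2)] by simp
qed

text \<open>One side of the triangle with incentre at the origin and inradius \<open>t\<close>;
  \<open>r\<close> is the radius of the opposite vertex. The half angles add up to
  \<open>pi / 2\<close>, so the side is seen under the angle \<open>x\<close>. From
  \<open>cos x = - t / r\<close> follow both the closed formula and the sign of the second
  derivative.\<close>

lemma chord_with_inradius:
  assumes "0 < t" "t < p" "t < q" "t < r"
    and "arcsin (t / p) + arcsin (t / q) + arcsin (t / r) = pi / 2"
  defines "x \<equiv> pi / 2 + arcsin (t / r)"
  shows "chord p q x = t * (cot (arcsin (t / p)) + cot (arcsin (t / q)))"
    and "chord p q x = sqrt (p\<^sup>2 + q\<^sup>2 + 2 * t * p * q / r)"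
    and "chord_deriv p q x = t"
    and "chord_deriv2 p q x < 0"
proof -
  have b: "0 < arcsin (t / p)" "arcsin (t / p) < pi / 2" "0 < arcsin (t / q)" "arcsin (t / q) < pi / 2"
    using arcsin_quotient_bounds assms(1-4) by auto
  have s: "sin (arcsin (t / p)) = t / p" "sin (arcsin (t / q)) = t / q" "sin (arcsin (t / r)) = t / r"
    using assms(1-4) by (auto intro!: sin_arcsin simp: field_simps)
  have x: "x = pi - arcsin (t / p) - arcsin (t / q)"
    using assms(5) unfolding x_def by linarith
  have pq: "t / sin (arcsin (t / p)) = p" "t / sin (arcsin (t / q)) = q"
    unfolding s using assms(1-4) by auto
  show c: "chord p q x = t * (cot (arcsin (t / p)) + cot (arcsin (t / q)))"
    using chord_at_incentre(1)[OF b assms(1)] unfolding pq x .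
  show d: "chord_deriv p q x = t"
    using chord_at_incentre(2)[OF b assms(1)] unfolding pq x .
  have cx: "cos x = - (t / r)" by (simp add: x_def cos_add s)
  show "chord p q x = sqrt (p\<^sup>2 + q\<^sup>2 + 2 * t * p * q / r)"
    unfolding chord_def cx by (simp add: ac_simps)
  have "0 < chord p q x"
    unfolding c cot_def using b assms(1) by (intro mult_pos_pos add_pos_pos divide_pos_pos cos_gt_zero sin_gt_zero) auto
  moreover have "p * q * cos x - t\<^sup>2 < 0"
  proof -
    have "0 < p * q * (t / r)" "0 < t\<^sup>2" using assms(1-4) by simp_all
    then show ?thesis unfolding cx mult_minus_right by linarith
  qed
  ultimately show "chord_deriv2 p q x < 0"
    unfolding chord_deriv2_def d by (rule divide_neg_pos[rotated])
qed

lemma tan_half_eq: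
  fixes x :: real
  assumes "0 < x" "x < pi"
  shows "tan (x / 2) = (1 - cos x) / sin x"
proof -
  have s: "0 < sin x" using assms by (rule sin_gt_zero)
  have c: "-1 < cos x" using cos_monotone_0_pi[of x pi] assms by simp
  have "sin x * sin x = (1 - cos x) * (cos x + 1)"
    using sin_cos_squared_add[of x] by algebra
  then have "sin x / (cos x + 1) = (1 - cos x) / sin x"
    using s c by (simp add: frac_eq_eq)
  then show ?thesis using tan_half[of "x / 2"] by simp
qed

text \<open>The tangent lengths from the vertices to the incircle are \<open>t * cot \<alpha>\<close>, and
  \<open>r\<^sub>2 - t * cot \<beta> = t * tan (\<beta> / 2)\<close>, so superadditivity of \<open>tan\<close> compares the triangle with the
  longest parade.\<close>

lemma cot_sum_gt:
  fixes \<alpha> \<beta> \<gamma> :: real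
  assumes "0 < \<alpha>" "0 < \<beta>" "0 < \<gamma>" "\<alpha> + \<beta> + \<gamma> = pi / 2"
  shows "1 / sin \<beta> + 1 / sin \<gamma> < cot \<alpha> + cot \<beta> + cot \<gamma>"
proof -
  have s: "0 < sin \<beta>" "0 < sin \<gamma>" using assms by (auto intro: sin_gt_zero)
  have "tan (\<beta> / 2) + tan (\<gamma> / 2) < tan (\<beta> / 2 + \<gamma> / 2)"
    using assms by (intro tan_superadditive) auto
  also have "\<dots> < tan (\<beta> + \<gamma>)"
    using assms by (intro tan_monotone) auto
  also have "\<beta> + \<gamma> = pi / 2 - \<alpha>" using assms by simp
  also have "tan (pi / 2 - \<alpha>) = cot \<alpha>" by (simp add: tan_def cot_def sin_diff cos_diff)
  finally have "tan (\<beta> / 2) + tan (\<gamma> / 2) < cot \<alpha>" .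
  moreover have "tan (\<beta> / 2) = 1 / sin \<beta> - cot \<beta>" "tan (\<gamma> / 2) = 1 / sin \<gamma> - cot \<gamma>"
    using tan_half_eq[of \<beta>] tan_half_eq[of \<gamma>] assms by (simp_all add: cot_def diff_divide_distrib)
  ultimately show ?thesis by simp
qed

section \<open>Classification of the critical angles\<close>

lemma chord_deriv_pos_iff:
  assumes "0 < p" "0 < q" "p \<noteq> q"
  shows "0 < chord_deriv p q x \<longleftrightarrow> 0 < sin x"
proof -
  have "0 < p * q" using assms by simp
  then show ?thesis
    using chord_pos[OF assms, of x] unfolding chord_deriv_def
    by (metis divide_pos_pos mult_pos_pos zero_less_divide_iff zero_less_mult_pos order_less_asym)
qed

lemma chord_deriv_eq_0_iff:
  assumes "0 < p" "0 < q" "p \<noteq> q"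
  shows "chord_deriv p q x = 0 \<longleftrightarrow> sin x = 0"
  using chord_pos[OF assms, of x] assms by (simp add: chord_deriv_def)

lemma sin_pos_imp_pos:
  fixes x :: real
  assumes "0 < sin x" "- pi \<le> x" "x \<le> pi"
  shows "0 < x" "x < pi"
proof -
  show "0 < x" using assms sin_ge_zero[of "- x"] by (cases "0 < x") auto
  show "x < pi" using assms by (cases "x = pi") auto
qed

text \<open>A positive common distance fixes the orientation: \<open>b\<close>, \<open>- a\<close>
  and the remaining angle lie between 0 and \<open>pi\<close> and complete a full turn. The origin
  is then the incentre, and uniqueness of the positive root gives \<open>d = t\<close>.\<close>

lemma critical_angles_pos:
  assumes r: "0 < r1" "r1 < r2" "r2 < r3"
    and t: "0 < t" "2 * r1 * r2 * r3 * t ^ 3 + (r1\<^sup>2 * r2\<^sup>2 + r2\<^sup>2 * r3\<^sup>2 + r3\<^sup>2 * r1\<^sup>2) * t\<^sup>2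
              - r1\<^sup>2 * r2\<^sup>2 * r3\<^sup>2 = 0"
    and ab: "- pi \<le> a" "a \<le> pi" "- pi \<le> b" "b \<le> pi"
    and d: "0 < d" "chord_deriv r1 r2 (a - b) = d" "chord_deriv r2 r3 b = d" "chord_deriv r1 r3 a = - d"
  shows "a = - (pi / 2 + arcsin (t / r2))" "b = pi / 2 + arcsin (t / r1)"
proof -
  have b: "0 < b" "b < pi"
    using chord_deriv_pos_iff[of r2 r3 b] sin_pos_imp_pos[of b] r d ab by auto
  have a: "0 < - a" "- a < pi"
    using chord_deriv_pos_iff[of r1 r3 "- a"] sin_pos_imp_pos[of "- a"] r d ab by auto
  \<comment> \<open>This is \<open>a - b\<close> plus a full turn. It lies between 0 and
    \<open>2 * pi\<close>, and positivity of its sine then puts it below \<open>pi\<close>.\<close>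
  define x where "x = 2 * pi - b - (- a)"
  have dx: "chord_deriv r1 r2 x = d"
    using chord_deriv_diff_2pi[of r1 r2 x] d by (simp add: x_def algebra_simps)
  then have "0 < sin x" using chord_deriv_pos_iff[of r1 r2 x] r d by auto
  moreover have x0: "0 < x" using a b by (simp add: x_def)
  moreover have "x < pi"
  proof (rule ccontr)
    assume "\<not> x < pi"
    then have "sin x \<le> 0" using a b by (intro sin_le_zero) (auto simp: x_def)
    with \<open>0 < sin x\<close> show False by simp
  qed
  moreover have "x + b + (- a) = 2 * pi" by (simp add: x_def)
  moreover have "chord_deriv r1 r3 (- a) = d" using d by simp
  ultimately have *: "b = pi / 2 + arcsin (d / r1)" "- a = pi / 2 + arcsin (d / r2)"
    "arcsin (d / r1) + arcsin (d / r2) + arcsin (d / r3) = pi / 2" "d < r1"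
    using equal_chord_deriv_imp_incentre[OF r x0 _ b a _ dx d(3)] by blast+
  have "d = t"
    using incircle_cubic[OF d(1) *(4) r(2,3) *(3)] incircle_cubic_unique[of r1 r2 r3 d t] r t d by auto
  with * show "a = - (pi / 2 + arcsin (t / r2))" "b = pi / 2 + arcsin (t / r1)" by auto
qed

text \<open>Polar angles of the first two vertices: the side joining a vertex to the third one is
  seen under \<open>pi / 2\<close> plus the half angle at the remaining vertex. Negating the pair
  reflects the triangle in the real axis.\<close>

definition incircle_angles :: "real \<Rightarrow> real \<Rightarrow> real \<Rightarrow> real \<times> real" where
  "incircle_angles r1 r2 t = (- (pi / 2 + arcsin (t / r2)), pi / 2 + arcsin (t / r1))"

text \<open>Split by the sign of the common distance \<open>d\<close>. For \<open>d = 0\<close> both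
  sines vanish, a positive \<open>d\<close> gives one triangle, and a negative \<open>d\<close> is
  reduced to the positive case by reflection.\<close>

lemma critical_angles:
  assumes r: "0 < r1" "r1 < r2" "r2 < r3"
    and t: "0 < t" "2 * r1 * r2 * r3 * t ^ 3 + (r1\<^sup>2 * r2\<^sup>2 + r2\<^sup>2 * r3\<^sup>2 + r3\<^sup>2 * r1\<^sup>2) * t\<^sup>2
              - r1\<^sup>2 * r2\<^sup>2 * r3\<^sup>2 = 0"
    and ab: "- pi < a" "a \<le> pi" "- pi < b" "b \<le> pi"
    and crit: "critical_point (perimeter \<circ> polar_circuit r1 r2 r3) (a, b)"
  shows "(a, b) \<in> {0, pi} \<times> {0, pi} \<union> {incircle_angles r1 r2 t, - incircle_angles r1 r2 t}"
proof -
  define d where "d = chord_deriv r1 r2 (a - b)"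
  have d: "chord_deriv r2 r3 b = d" "chord_deriv r1 r3 a = - d"
    using crit unfolding critical_point_perimeter_iff[OF r] d_def by auto
  consider "d = 0" | "d > 0" | "d < 0" by linarith
  then show ?thesis
  proof cases
    case 1
    then have s: "sin a = 0" "sin b = 0"
      using d chord_deriv_eq_0_iff[of r2 r3 b] chord_deriv_eq_0_iff[of r1 r3 a] r by auto
    have "x = 0 \<or> x = pi" if "sin x = 0" "- pi < x" "x \<le> pi" for x :: real
      using that sin_eq_0_pi[of x] by force
    with s ab show ?thesis by blast
  next
    case 2
    note pos = critical_angles_pos[OF r t less_imp_le[OF ab(1)] ab(2) less_imp_le[OF ab(3)] ab(4)
        2 d_def[symmetric] d]
    show ?thesis unfolding incircle_angles_def pos by simp
  next
    case 3
    then have "0 < - d" by simp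
    have le: "- pi \<le> - a" "- a \<le> pi" "- pi \<le> - b" "- b \<le> pi" using ab by auto
    have eqs: "chord_deriv r1 r2 (- a - - b) = - d" "chord_deriv r2 r3 (- b) = - d"
      "chord_deriv r1 r3 (- a) = - (- d)"
      using chord_deriv_minus[of r1 r2 "a - b"] d by (simp_all add: d_def)
    note pos = critical_angles_pos[OF r t le \<open>0 < - d\<close> eqs]
    have "(a, b) = - incircle_angles r1 r2 t"
      unfolding incircle_angles_def using pos by simp
    then show ?thesis by blast
  qed
qed

lemma incircle_angles_bounds:
  assumes "0 < t" "t < r1" "r1 < r2"
  shows "- pi < fst (incircle_angles r1 r2 t)" "fst (incircle_angles r1 r2 t) < - (pi / 2)"
    "pi / 2 < snd (incircle_angles r1 r2 t)" "snd (incircle_angles r1 r2 t) < pi"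
  using arcsin_quotient_bounds[of t r1] arcsin_quotient_bounds[of t r2] assms
  by (auto simp: incircle_angles_def)

section \<open>Hessians at the parades\<close>

lemma chord_deriv2_0: "0 < p \<Longrightarrow> p < q \<Longrightarrow> chord_deriv2 p q 0 = p * q / (q - p)"
  by (simp add: chord_deriv2_def chord_deriv_def chord_0)

lemma chord_deriv2_pi: "0 < p \<Longrightarrow> 0 < q \<Longrightarrow> chord_deriv2 p q pi = - (p * q / (p + q))"
  by (simp add: chord_deriv2_def chord_deriv_def chord_pi)

text \<open>The determinant is written through reciprocals because at a parade \<open>1 / A\<close>,
  \<open>1 / B\<close>, \<open>1 / C\<close> are linear in the reciprocals of the radii.\<close>

lemma sym2_neg:
  fixes A B C :: real
  assumes "0 < A * B * C" "1 / A + 1 / B + 1 / C < 0"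
  shows "A * B + B * C + C * A < 0"
proof -
  have "A \<noteq> 0" "B \<noteq> 0" "C \<noteq> 0" using assms(1) by auto
  then have "A * B + B * C + C * A = (A * B * C) * (1 / A + 1 / B + 1 / C)"
    by (simp add: field_simps)
  with assms show ?thesis by (simp add: mult_pos_neg)
qed

lemma parade_critical:
  assumes "0 < r1" "r1 < r2" "r2 < r3" "\<theta> \<in> {0, pi} \<times> {0, pi}"
  shows "critical_point (perimeter \<circ> polar_circuit r1 r2 r3) \<theta>"
proof -
  obtain a b where \<theta>: "\<theta> = (a, b)" by (cases \<theta>)
  show ?thesis
    using assms(4) unfolding \<theta> critical_point_perimeter_iff[OF assms(1-3)]
    by (auto simp: chord_deriv_def)
qed

text \<open>In each case exactly two of \<open>A\<close>, \<open>B\<close>, \<open>C\<close> are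
  negative, so the product is positive. The reciprocals add up to \<open>- 2 / r1 - 2 / r3\<close>
  in the first case and to \<open>- 2 / r2 - 2 / r3\<close> in the other two.\<close>

lemma parade_sym2_neg:
  assumes r: "0 < r1" "r1 < r2" "r2 < r3"
    and ab: "a \<in> {0, pi}" "b \<in> {0, pi}" "(a, b) \<noteq> (0, 0)"
  defines "A \<equiv> chord_deriv2 r1 r2 (a - b)" and "B \<equiv> chord_deriv2 r2 r3 b" and "C \<equiv> chord_deriv2 r1 r3 a"
  shows "A * B + B * C + C * A < 0"
proof -
  have sum: "1 / (p * q / (p + q)) = 1 / p + 1 / q" if "0 < p" "0 < q" for p q :: real
    using that by (simp add: field_simps)
  have diff: "1 / (p * q / (q - p)) = 1 / p - 1 / q" if "0 < p" "p < q" for p q :: real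
    using that by (simp add: field_simps)
  have u: "0 < 1 / r1" "0 < 1 / r2" "0 < 1 / r3" using r by auto
  have pos: "0 < p * q / (p + q)" if "0 < p" "0 < q" for p q :: real
    using that by simp
  have pos': "0 < p * q / (q - p)" if "0 < p" "p < q" for p q :: real
    using that by simp
  have r': "0 < r2" "0 < r3" "r1 < r3" using r by auto
  consider "a = pi" "b = 0" | "a = 0" "b = pi" | "a = pi" "b = pi" using ab by auto
  then show ?thesis
  proof cases
    case 1
    have ABC: "A = - (r1 * r2 / (r1 + r2))" "B = r2 * r3 / (r3 - r2)" "C = - (r1 * r3 / (r1 + r3))"
      using r by (simp_all add: A_def B_def C_def 1 chord_deriv2_0 chord_deriv2_pi)
    show ?thesis
    proof (rule sym2_neg)
      show "0 < A * B * C" unfolding ABC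
        using mult_pos_pos[OF mult_pos_pos[OF pos[OF r(1) r'(1)] pos'[OF r'(1) r(3)]] pos[OF r(1) r'(2)]] by (simp only: mult_minus_left mult_minus_right minus_minus)
      show "1 / A + 1 / B + 1 / C < 0"
        unfolding ABC divide_minus_right sum[OF r(1) r'(1)] diff[OF r'(1) r(3)] sum[OF r(1) r'(2)]
        using u by linarith
    qed
  next
    case 2
    have ABC: "A = - (r1 * r2 / (r1 + r2))" "B = - (r2 * r3 / (r2 + r3))" "C = r1 * r3 / (r3 - r1)"
      using r by (simp_all add: A_def B_def C_def 2 chord_deriv2_0 chord_deriv2_pi)
    show ?thesis
    proof (rule sym2_neg)
      show "0 < A * B * C" unfolding ABC
        using mult_pos_pos[OF mult_pos_pos[OF pos[OF r(1) r'(1)] pos[OF r'(1,2)]] pos'[OF r(1) r'(3)]] by (simp only: mult_minus_left mult_minus_right minus_minus)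
      show "1 / A + 1 / B + 1 / C < 0"
        unfolding ABC divide_minus_right sum[OF r(1) r'(1)] sum[OF r'(1,2)] diff[OF r(1) r'(3)]
        using u by linarith
    qed
  next
    case 3
    have ABC: "A = r1 * r2 / (r2 - r1)" "B = - (r2 * r3 / (r2 + r3))" "C = - (r1 * r3 / (r1 + r3))"
      using r by (simp_all add: A_def B_def C_def 3 chord_deriv2_0 chord_deriv2_pi)
    show ?thesis
    proof (rule sym2_neg)
      show "0 < A * B * C" unfolding ABC
        using mult_pos_pos[OF mult_pos_pos[OF pos'[OF r(1,2)] pos[OF r'(1,2)]] pos[OF r(1) r'(2)]] by (simp only: mult_minus_left mult_minus_right minus_minus)
      show "1 / A + 1 / B + 1 / C < 0"
        unfolding ABC divide_minus_right diff[OF r(1,2)] sum[OF r'(1,2)] sum[OF r(1) r'(2)]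
        using u by linarith
    qed
  qed
qed

lemma saddle_point_perimeter:
  assumes r: "0 < r1" "r1 < r2" "r2 < r3"
    and "\<theta> \<in> {0, pi} \<times> {0, pi}" "\<theta> \<noteq> (0, 0)"
  shows "saddle_point (perimeter \<circ> polar_circuit r1 r2 r3) \<theta>"
proof -
  obtain a b where \<theta>: "\<theta> = (a, b)" by (cases \<theta>)
  let ?A = "chord_deriv2 r1 r2 (a - b)" and ?B = "chord_deriv2 r2 r3 b" and ?C = "chord_deriv2 r1 r3 a"
  have "?A * ?B + ?B * ?C + ?C * ?A < 0"
    using parade_sym2_neg[OF r, of a b] assms(4,5) by (auto simp: \<theta>)
  then have det: "(?A + ?C) * (?A + ?B) < (- ?A)\<^sup>2"
    by (simp add: algebra_simps power2_eq_square)
  show ?thesis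
    unfolding saddle_point_def
    using binary_form_nondegenerate[OF less_imp_neq[OF det] hessian_perimeter_form[OF r] parade_critical[OF r assms(4), unfolded \<theta>]]
      binary_form_morse_index[OF det hessian_perimeter_form[OF r]] by (simp add: \<theta>)
qed

text \<open>The last hypothesis is the Hessian determinant in expanded form.\<close>

lemma nondegenerate_if_sym2_pos:
  assumes r: "0 < r1" "r1 < r2" "r2 < r3"
    and "critical_point (perimeter \<circ> polar_circuit r1 r2 r3) (a, b)"
    and "0 < chord_deriv2 r1 r2 (a - b) * chord_deriv2 r2 r3 b + chord_deriv2 r2 r3 b * chord_deriv2 r1 r3 a
      + chord_deriv2 r1 r3 a * chord_deriv2 r1 r2 (a - b)"
  shows "nondegenerate_critical_point (perimeter \<circ> polar_circuit r1 r2 r3) (a, b)"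
proof -
  let ?A = "chord_deriv2 r1 r2 (a - b)" and ?B = "chord_deriv2 r2 r3 b" and ?C = "chord_deriv2 r1 r3 a"
  have "(?A + ?C) * (?A + ?B) - (- ?A)\<^sup>2 = ?A * ?B + ?B * ?C + ?C * ?A" by algebra
  then have "(?A + ?C) * (?A + ?B) \<noteq> (- ?A)\<^sup>2" using assms(5) by linarith
  then show ?thesis
    by (rule binary_form_nondegenerate[OF _ hessian_perimeter_form[OF r] assms(4)])
qed

lemma nondegenerate_shortest:
  assumes r: "0 < r1" "r1 < r2" "r2 < r3"
  shows "nondegenerate_critical_point (perimeter \<circ> polar_circuit r1 r2 r3) (0, 0)"
proof (rule nondegenerate_if_sym2_pos[OF r])
  show "critical_point (perimeter \<circ> polar_circuit r1 r2 r3) (0, 0)"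
    by (rule parade_critical[OF r]) simp
  have "0 < chord_deriv2 r1 r2 0" "0 < chord_deriv2 r2 r3 0" "0 < chord_deriv2 r1 r3 0"
    using r by (simp_all add: chord_deriv2_0)
  then show "0 < chord_deriv2 r1 r2 (0 - 0) * chord_deriv2 r2 r3 0 + chord_deriv2 r2 r3 0 * chord_deriv2 r1 r3 0
      + chord_deriv2 r1 r3 0 * chord_deriv2 r1 r2 (0 - 0)"
    by (simp add: add_pos_pos)
qed

section \<open>The two critical triangles\<close>

text \<open>The vertices \<open>p\<^sub>1\<close>, \<open>p\<^sub>2\<close> lie on different sides of the real axis and left of the
  imaginary axis, so the line joining them misses \<open>p\<^sub>3 > 0\<close>.\<close>

lemma nondegenerate_triangle_polar_circuit:
  assumes r: "0 < r1" "0 < r2" "0 < r3"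
    and "sin a * sin b < 0" "cos a < 0" "cos b < 0"
  shows "nondegenerate_triangle (polar_circuit r1 r2 r3 (a, b))"
proof -
  let ?p = "rcis r1 a - Complex r3 0" and ?q = "rcis r2 b - Complex r3 0"
  have "\<not> collinear {rcis r1 a, rcis r2 b, Complex r3 0}"
  proof
    assume "collinear {rcis r1 a, rcis r2 b, Complex r3 0}"
    then obtain u where "\<forall>x\<in>{rcis r1 a, rcis r2 b, Complex r3 0}.
        \<forall>y\<in>{rcis r1 a, rcis r2 b, Complex r3 0}. \<exists>c. x - y = c *\<^sub>R u"
      unfolding collinear_def by blast
    then obtain c d where "?p = c *\<^sub>R u" "?q = d *\<^sub>R u" by blast
    \<comment> \<open>Two multiples of the same vector have vanishing cross product; the signs of
      the coordinates contradict this.\<close>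
    then have "Re ?p * Im ?q = Im ?p * Re ?q" by (simp only: scaleR_complex.sel mult_ac)
    then have eq: "(r1 * cos a - r3) * (r2 * sin b) = (r1 * sin a) * (r2 * cos b - r3)" by simp
    have neg: "r1 * cos a - r3 < 0" "r2 * cos b - r3 < 0"
      using r assms(5,6) mult_pos_neg[of r1 "cos a"] mult_pos_neg[of r2 "cos b"] by auto
    consider "sin a < 0" "0 < sin b" | "0 < sin a" "sin b < 0"
      using assms(4) by (auto simp: mult_less_0_iff)
    then show False
    proof cases
      case 1
      then have "(r1 * cos a - r3) * (r2 * sin b) < 0" "0 < (r1 * sin a) * (r2 * cos b - r3)"
        using neg r by (auto intro: mult_neg_pos mult_neg_neg mult_pos_neg simp del: diff_less_0_iff_less)
      with eq show False by simp
    next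
      case 2
      then have "0 < (r1 * cos a - r3) * (r2 * sin b)" "(r1 * sin a) * (r2 * cos b - r3) < 0"
        using neg r by (auto intro: mult_pos_neg mult_neg_neg simp del: diff_less_0_iff_less)
      with eq show False by simp
    qed
  qed
  then show ?thesis by (simp add: nondegenerate_triangle_def polar_circuit_def)
qed

text \<open>The three half angles \<alpha>, \<beta>, \<gamma> determine everything up to reflection.
  All second derivatives of the sides are negative, so the Hessian determinant is positive, and
  \<open>cot_sum_gt\<close> bounds the perimeter from below.\<close>

lemma incircle_triangle:
  assumes r: "0 < r1" "r1 < r2" "r2 < r3"
    and t: "0 < t" "t < r1" "arcsin (t / r1) + arcsin (t / r2) + arcsin (t / r3) = pi / 2"
    and \<theta>: "\<theta> \<in> {incircle_angles r1 r2 t, - incircle_angles r1 r2 t}"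
  shows "nondegenerate_critical_point (perimeter \<circ> polar_circuit r1 r2 r3) \<theta>"
    and "perimeter (polar_circuit r1 r2 r3 \<theta>) = sqrt (r1\<^sup>2 + r2\<^sup>2 + 2 * t * r1 * r2 / r3)
           + sqrt (r1\<^sup>2 + r3\<^sup>2 + 2 * t * r1 * r3 / r2)
           + sqrt (r2\<^sup>2 + r3\<^sup>2 + 2 * t * r2 * r3 / r1)"
    and "2 * (r2 + r3) < perimeter (polar_circuit r1 r2 r3 \<theta>)"
    and "nondegenerate_triangle (polar_circuit r1 r2 r3 \<theta>)"
proof -
  obtain a b where ab: "\<theta> = (a, b)" by (cases \<theta>)
  define \<alpha> \<beta> \<gamma> where "\<alpha> = arcsin (t / r1)" and "\<beta> = arcsin (t / r2)" and "\<gamma> = arcsin (t / r3)"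
  have t': "t < r2" "t < r3" using r t by auto
  have sum: "\<alpha> + \<beta> + \<gamma> = pi / 2" using t(3) by (simp add: \<alpha>_def \<beta>_def \<gamma>_def)
  have abe: "(a = - (pi / 2 + \<beta>) \<and> b = pi / 2 + \<alpha>) \<or> (a = pi / 2 + \<beta> \<and> b = - (pi / 2 + \<alpha>))"
    using \<theta> unfolding ab incircle_angles_def \<alpha>_def \<beta>_def by auto
  \<comment> \<open>Lengths, second derivatives and cosines are even and periodic, so both mirror
    images reduce to the same three central angles.\<close>
  have even: "f a = f (pi / 2 + \<beta>)" "f b = f (pi / 2 + \<alpha>)" "f (a - b) = f (pi / 2 + \<gamma>)"
    if "\<And>x. f (- x) = f x" "\<And>x. f (x - 2 * pi) = f x" for f :: "real \<Rightarrow> real"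
  proof -
    show "f a = f (pi / 2 + \<beta>)" "f b = f (pi / 2 + \<alpha>)" using abe that(1) by metis+
    have "a - b = (pi / 2 + \<gamma>) - 2 * pi \<or> - (a - b) = (pi / 2 + \<gamma>) - 2 * pi"
      using abe sum by auto
    then show "f (a - b) = f (pi / 2 + \<gamma>)" using that by metis
  qed
  note c12 = chord_with_inradius[OF t(1,2) t' t(3), folded \<alpha>_def \<beta>_def \<gamma>_def]
  have "arcsin (t / r2) + arcsin (t / r3) + arcsin (t / r1) = pi / 2" using t(3) by simp
  note c23 = chord_with_inradius[OF t(1) t' t(2) this, folded \<alpha>_def \<beta>_def \<gamma>_def]
  have "arcsin (t / r1) + arcsin (t / r3) + arcsin (t / r2) = pi / 2" using t(3) by simp
  note c13 = chord_with_inradius[OF t(1,2) t'(2,1) this, folded \<alpha>_def \<beta>_def \<gamma>_def]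
  \<comment> \<open>Signed distances are odd instead of even, so the two mirror images are treated
    separately.\<close>
  have crit: "critical_point (perimeter \<circ> polar_circuit r1 r2 r3) (a, b)"
    unfolding critical_point_perimeter_iff[OF r]
    using abe
  proof (elim disjE conjE)
    assume a: "a = - (pi / 2 + \<beta>)" and b: "b = pi / 2 + \<alpha>"
    have diff: "a - b = (pi / 2 + \<gamma>) - 2 * pi" using a b sum by simp
    show "chord_deriv r2 r3 b = chord_deriv r1 r2 (a - b) \<and> chord_deriv r1 r3 a = - chord_deriv r1 r2 (a - b)"
      unfolding diff chord_deriv_diff_2pi c12(3) unfolding a b chord_deriv_minus c13(3) c23(3) by simp
  next
    assume a: "a = pi / 2 + \<beta>" and b: "b = - (pi / 2 + \<alpha>)"
    have diff: "a - b = - ((pi / 2 + \<gamma>) - 2 * pi)" using a b sum by simp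
    show "chord_deriv r2 r3 b = chord_deriv r1 r2 (a - b) \<and> chord_deriv r1 r3 a = - chord_deriv r1 r2 (a - b)"
      unfolding diff chord_deriv_minus chord_deriv_diff_2pi c12(3)
      unfolding a b chord_deriv_minus c13(3) c23(3) by simp
  qed
  show "nondegenerate_critical_point (perimeter \<circ> polar_circuit r1 r2 r3) \<theta>"
    unfolding ab
  proof (rule nondegenerate_if_sym2_pos[OF r crit])
    show "0 < chord_deriv2 r1 r2 (a - b) * chord_deriv2 r2 r3 b + chord_deriv2 r2 r3 b * chord_deriv2 r1 r3 a
      + chord_deriv2 r1 r3 a * chord_deriv2 r1 r2 (a - b)"
      unfolding even(3)[of "chord_deriv2 r1 r2", OF chord_deriv2_minus chord_deriv2_diff_2pi]
        even(2)[of "chord_deriv2 r2 r3", OF chord_deriv2_minus chord_deriv2_diff_2pi]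
        even(1)[of "chord_deriv2 r1 r3", OF chord_deriv2_minus chord_deriv2_diff_2pi]
      using c12(4) c23(4) c13(4) by (intro add_pos_pos mult_neg_neg)
  qed
  have per: "perimeter (polar_circuit r1 r2 r3 \<theta>) =
      chord r1 r2 (pi / 2 + \<gamma>) + chord r2 r3 (pi / 2 + \<alpha>) + chord r1 r3 (pi / 2 + \<beta>)"
    unfolding ab perimeter_polar_circuit
      even(3)[of "chord r1 r2", OF chord_minus chord_diff_2pi]
        even(2)[of "chord r2 r3", OF chord_minus chord_diff_2pi]
        even(1)[of "chord r1 r3", OF chord_minus chord_diff_2pi] ..
  show "perimeter (polar_circuit r1 r2 r3 \<theta>) = sqrt (r1\<^sup>2 + r2\<^sup>2 + 2 * t * r1 * r2 / r3)
           + sqrt (r1\<^sup>2 + r3\<^sup>2 + 2 * t * r1 * r3 / r2)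
           + sqrt (r2\<^sup>2 + r3\<^sup>2 + 2 * t * r2 * r3 / r1)"
    unfolding per c12(2) c13(2) c23(2) by simp
  have s: "sin \<beta> = t / r2" "sin \<gamma> = t / r3"
    unfolding \<beta>_def \<gamma>_def using t r t' by (auto intro!: sin_arcsin simp: field_simps)
  have pos: "0 < \<alpha>" "0 < \<beta>" "0 < \<gamma>"
    using arcsin_quotient_bounds t t' by (auto simp: \<alpha>_def \<beta>_def \<gamma>_def)
  \<comment> \<open>Each radius is \<open>t\<close> over the sine of its half angle, and each vertex
    contributes two tangent lengths to the perimeter, which is thus \<open>2 * t\<close> times the
    sum of the cotangents.\<close>
  have "2 * (r2 + r3) = 2 * t * (1 / sin \<beta> + 1 / sin \<gamma>)"
    unfolding s using t r t' by (simp add: field_simps)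
  also have "\<dots> < 2 * t * (cot \<alpha> + cot \<beta> + cot \<gamma>)"
    using cot_sum_gt[OF pos sum] t by simp
  also have "\<dots> = perimeter (polar_circuit r1 r2 r3 \<theta>)"
    unfolding per c12(1) c23(1) c13(1) by (simp add: algebra_simps)
  finally show "2 * (r2 + r3) < perimeter (polar_circuit r1 r2 r3 \<theta>)" .
  have "0 < sin (pi / 2 + \<alpha>)" "0 < sin (pi / 2 + \<beta>)"
    using pos sum by (auto intro!: sin_gt_zero)
  moreover have "(sin a = - sin (pi / 2 + \<beta>) \<and> sin b = sin (pi / 2 + \<alpha>)) \<or>
      (sin a = sin (pi / 2 + \<beta>) \<and> sin b = - sin (pi / 2 + \<alpha>))"
    using abe by (metis sin_minus)
  ultimately have sab: "sin a * sin b < 0"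
    by (auto simp: mult_less_0_iff)
  have "cos (x - 2 * pi) = cos x" for x by (simp add: cos_diff)
  then have "cos a = cos (pi / 2 + \<beta>)" "cos b = cos (pi / 2 + \<alpha>)"
    by (auto intro!: even)
  then have cab: "cos a < 0" "cos b < 0"
    using pos sum by (auto simp: cos_add intro!: sin_gt_zero)
  show "nondegenerate_triangle (polar_circuit r1 r2 r3 \<theta>)"
    unfolding ab by (rule nondegenerate_triangle_polar_circuit[OF _ _ _ sab cab]) (use r in auto)
qed

section \<open>The minimum, the parades and the existence of a maximum\<close>

text \<open>Every side is at least the difference of its radii, and these differences add up to
  \<open>2 * (r3 - r1)\<close>. Equality on the two sides at the third vertex forces both other
  polar angles to be multiples of a full turn.\<close>

lemma shortest_unique_min:
  assumes r: "0 < r1" "r1 < r2" "r2 < r3"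
    and P: "P \<in> reduced_circuits r1 r2 r3" "P \<noteq> shortest_parade r1 r2 r3"
  shows "2 * (r3 - r1) < perimeter P"
proof -
  obtain a b where ab: "P = polar_circuit r1 r2 r3 (a, b)"
    using P(1) polar_circuit_polar_angles by (metis surj_pair)
  have ge: "r2 - r1 \<le> chord r1 r2 (a - b)" "r3 - r2 \<le> chord r2 r3 b" "r3 - r1 \<le> chord r1 r3 a"
    using chord_ge[of r1 r2 "a - b"] chord_ge[of r2 r3 b] chord_ge[of r1 r3 a] r by auto
  show ?thesis
  proof (rule ccontr)
    assume "\<not> ?thesis"
    with ge have "chord r2 r3 b = r3 - r2" "chord r1 r3 a = r3 - r1"
      by (auto simp: ab perimeter_polar_circuit)
    then have "cos a = 1" "cos b = 1"
      using chord_eq_imp_cos[of r1 r3 a] chord_eq_imp_cos[of r2 r3 b] r by auto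
    moreover have "sin x = 0" if "cos x = 1" for x :: real
      using sin_cos_squared_add[of x] that by simp
    ultimately have "P = shortest_parade r1 r2 r3"
      by (simp add: ab shortest_parade_def polar_circuit_def complex_eq_iff)
    with P(2) show False by simp
  qed
qed

lemma parades_eq:
  assumes r: "0 < r1" "0 < r2" "0 < r3"
  shows "parades r1 r2 r3 = polar_circuit r1 r2 r3 ` ({0, pi} \<times> {0, pi})"
proof
  show "parades r1 r2 r3 \<subseteq> polar_circuit r1 r2 r3 ` ({0, pi} \<times> {0, pi})"
  proof
    fix P assume P: "P \<in> parades r1 r2 r3"
    then have "P = polar_circuit r1 r2 r3 (polar_angles P)"
      by (simp add: parades_def polar_circuit_polar_angles)
    moreover have "polar_angles P \<in> {0, pi} \<times> {0, pi}"
      using P by (auto simp: parades_def parade_def polar_angles_def split: prod.splits)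
    ultimately show "P \<in> polar_circuit r1 r2 r3 ` ({0, pi} \<times> {0, pi})" by (rule image_eqI)
  qed
  have A: "Arg (Complex r3 0) = 0"
    using r Arg_rcis[of 0 r3] by (simp add: rcis_def complex_of_real_def)
  show "polar_circuit r1 r2 r3 ` ({0, pi} \<times> {0, pi}) \<subseteq> parades r1 r2 r3"
  proof
    fix P assume "P \<in> polar_circuit r1 r2 r3 ` ({0, pi} \<times> {0, pi})"
    then obtain a b where ab: "a = 0 \<or> a = pi" "b = 0 \<or> b = pi" "P = polar_circuit r1 r2 r3 (a, b)"
      by auto
    have "P \<in> reduced_circuits r1 r2 r3" using range_polar_circuit[OF r] ab(3) by blast
    moreover have "Arg (rcis r1 a) = a" "Arg (rcis r2 b) = b"
      using ab r by (auto intro!: Arg_rcis)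
    then have "parade P" using A ab by (simp add: parade_def polar_circuit_def)
    ultimately show "P \<in> parades r1 r2 r3" by (simp add: parades_def)
  qed
qed

lemma inj_on_polar_circuit:
  assumes "0 < r1" "0 < r2"
  shows "inj_on (polar_circuit r1 r2 r3) ({-pi<..pi} \<times> {-pi<..pi})"
  using polar_angles_polar_circuit[OF assms] by (rule inj_on_inverseI)

lemma polar_angles_range: "polar_angles P \<in> {-pi<..pi} \<times> {-pi<..pi}"
  using mpi_less_Arg Arg_le_pi by (auto simp: polar_angles_def split: prod.splits)

text \<open>The configuration torus is compact, so a maximum exists. Lifted to all pairs of angles
  it is a maximum on an open set, where the derivative vanishes.\<close>

lemma perimeter_attains_max:
  assumes r: "0 < r1" "r1 < r2" "r2 < r3"
  obtains M where "M \<in> critical_circuits r1 r2 r3 perimeter"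
    "\<And>P. P \<in> reduced_circuits r1 r2 r3 \<Longrightarrow> perimeter P \<le> perimeter M"
proof -
  have eq: "reduced_circuits r1 r2 r3 = sphere 0 r1 \<times> sphere 0 r2 \<times> {Complex r3 0}"
    using r by (auto simp: reduced_circuits_def circuits_def complex_norm)
  have comp: "compact (reduced_circuits r1 r2 r3)"
    unfolding eq by (intro compact_Times compact_sphere) auto
  have ne: "reduced_circuits r1 r2 r3 \<noteq> {}"
    using range_polar_circuit[of r1 r2 r3] r by auto
  have "continuous_on (reduced_circuits r1 r2 r3) perimeter"
    unfolding perimeter_def case_prod_beta by (intro continuous_intros)
  from continuous_attains_sup[OF comp ne this] obtain M where
    M: "M \<in> reduced_circuits r1 r2 r3" "\<And>P. P \<in> reduced_circuits r1 r2 r3 \<Longrightarrow> perimeter P \<le> perimeter M"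
    by blast
  have "perimeter_deriv r1 r2 r3 (polar_angles M) = (\<lambda>_. 0)"
  proof (rule differential_zero_maxmin[OF _ open_UNIV has_derivative_perimeter[OF r]])
    have "(perimeter \<circ> polar_circuit r1 r2 r3) \<theta> \<le> (perimeter \<circ> polar_circuit r1 r2 r3) (polar_angles M)" for \<theta>
    proof -
      have "polar_circuit r1 r2 r3 \<theta> \<in> reduced_circuits r1 r2 r3"
        using range_polar_circuit[of r1 r2 r3] r by auto
      then show ?thesis using M(2) by (simp add: polar_circuit_polar_angles[OF M(1)])
    qed
    then show "(\<forall>y\<in>UNIV. (perimeter \<circ> polar_circuit r1 r2 r3) y \<le> (perimeter \<circ> polar_circuit r1 r2 r3) (polar_angles M)) \<or>
      (\<forall>y\<in>UNIV. (perimeter \<circ> polar_circuit r1 r2 r3) (polar_angles M) \<le> (perimeter \<circ> polar_circuit r1 r2 r3) y)"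
      by blast
  qed simp
  with has_derivative_perimeter[OF r, of "polar_angles M"]
  have "critical_point (perimeter \<circ> polar_circuit r1 r2 r3) (polar_angles M)"
    unfolding critical_point_def by simp
  with M that show ?thesis by (simp add: critical_circuits_def)
qed

section \<open>Critical values and the count of critical points\<close>

lemma perimeter_parades:
  assumes "0 < r1" "r1 < r2" "r2 < r3"
  shows "perimeter (polar_circuit r1 r2 r3 (0, 0)) = 2 * (r3 - r1)"
    "perimeter (polar_circuit r1 r2 r3 (0, pi)) = 2 * (r2 + r3)"
    "perimeter (polar_circuit r1 r2 r3 (pi, 0)) = 2 * (r1 + r3)"
    "perimeter (polar_circuit r1 r2 r3 (pi, pi)) = 2 * (r2 + r3)"
  using assms by (simp_all add: perimeter_polar_circuit chord_0 chord_pi)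

theorem theorem3:
  fixes r1 r2 r3 :: real
  assumes "0 < r1" and "r1 < r2" and "r2 < r3"
  shows "morse_function r1 r2 r3 perimeter \<and>
    card (critical_circuits r1 r2 r3 perimeter) = 6 \<and>
    card (parades r1 r2 r3) = 4 \<and>
    shortest_parade r1 r2 r3 \<in> parades r1 r2 r3 \<and>
    (\<forall>P \<in> reduced_circuits r1 r2 r3. P \<noteq> shortest_parade r1 r2 r3 \<longrightarrow>
       perimeter (shortest_parade r1 r2 r3) < perimeter P) \<and>
    (\<forall>P \<in> parades r1 r2 r3. P \<noteq> shortest_parade r1 r2 r3 \<longrightarrow>
       saddle_circuit r1 r2 r3 perimeter P) \<and>
    (\<exists>T1 T2. T1 \<noteq> T2 \<and>
       critical_circuits r1 r2 r3 perimeter = parades r1 r2 r3 \<union> {T1, T2} \<and>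
       (\<forall>T \<in> {T1, T2}. nondegenerate_triangle T \<and>
          (\<forall>P \<in> reduced_circuits r1 r2 r3. perimeter P \<le> perimeter T))) \<and>
    (\<exists>t L\<^sub>m L\<^sub>M.
       (\<forall>s. s > 0 \<and>
            2 * r1 * r2 * r3 * s ^ 3 + (r1\<^sup>2 * r2\<^sup>2 + r2\<^sup>2 * r3\<^sup>2 + r3\<^sup>2 * r1\<^sup>2) * s\<^sup>2
              - r1\<^sup>2 * r2\<^sup>2 * r3\<^sup>2 = 0 \<longleftrightarrow> s = t) \<and>
       L\<^sub>m = 2 * (r3 - r1) \<and>
       L\<^sub>M = sqrt (r1\<^sup>2 + r2\<^sup>2 + 2 * t * r1 * r2 / r3)
           + sqrt (r1\<^sup>2 + r3\<^sup>2 + 2 * t * r1 * r3 / r2)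
           + sqrt (r2\<^sup>2 + r3\<^sup>2 + 2 * t * r2 * r3 / r1) \<and>
       perimeter ` critical_circuits r1 r2 r3 perimeter =
         {L\<^sub>m, 2 * (r1 + r3), 2 * (r2 + r3), L\<^sub>M} \<and>
       L\<^sub>m < 2 * (r1 + r3) \<and> 2 * (r1 + r3) < 2 * (r2 + r3) \<and> 2 * (r2 + r3) < L\<^sub>M)"
proof -
  note r = assms
  have r': "0 < r2" "0 < r3" using r by auto
  obtain t where t: "0 < t" "t < r1" "arcsin (t / r1) + arcsin (t / r2) + arcsin (t / r3) = pi / 2"
    using incircle_radius_exists[OF r] .
  note cubic = incircle_cubic[OF t(1,2) r(2,3) t(3)]
  let ?F = "perimeter \<circ> polar_circuit r1 r2 r3"
  let ?box = "{-pi<..pi} \<times> {-pi<..pi}"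
  define \<theta> where "\<theta> = incircle_angles r1 r2 t"
  note \<theta> = incircle_angles_bounds[OF t(1,2) r(2), folded \<theta>_def]
  note tri = incircle_triangle[OF r t, folded \<theta>_def]
  let ?par = "{0, pi} \<times> {0, pi} :: (real \<times> real) set"
  define K where "K = ?par \<union> {\<theta>, - \<theta>}"
  define L where "L = sqrt (r1\<^sup>2 + r2\<^sup>2 + 2 * t * r1 * r2 / r3)
           + sqrt (r1\<^sup>2 + r3\<^sup>2 + 2 * t * r1 * r3 / r2)
           + sqrt (r2\<^sup>2 + r3\<^sup>2 + 2 * t * r2 * r3 / r1)"
  \<comment> \<open>On this fundamental square \<open>polar_angles\<close> inverts
    \<open>polar_circuit\<close>, so the six angle pairs give six distinct circuits.\<close>
  have K_box: "K \<subseteq> ?box"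
    using \<theta> unfolding K_def by (cases \<theta>) (auto simp: field_simps)
  \<comment> \<open>This also supplies criticality of the six pairs, hence the second inclusion in
    \<open>crit\<close>.\<close>
  have nondeg: "nondegenerate_critical_point ?F \<kappa>" if \<kappa>: "\<kappa> \<in> K" for \<kappa>
  proof -
    consider "\<kappa> \<in> {\<theta>, - \<theta>}" | "\<kappa> = (0, 0)" | "\<kappa> \<in> ?par" "\<kappa> \<noteq> (0, 0)"
      using \<kappa> unfolding K_def by blast
    then show ?thesis
    proof cases
      case 1
      then show ?thesis by (rule tri(1))
    next
      case 2
      then show ?thesis using nondegenerate_shortest[OF r] by simp
    next
      case 3
      then show ?thesis using saddle_point_perimeter[OF r] unfolding saddle_point_def by blast
    qed
  qed
  have crit: "critical_circuits r1 r2 r3 perimeter = polar_circuit r1 r2 r3 ` K"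
  proof
    show "critical_circuits r1 r2 r3 perimeter \<subseteq> polar_circuit r1 r2 r3 ` K"
    proof
      fix P assume "P \<in> critical_circuits r1 r2 r3 perimeter"
      then have P: "P \<in> reduced_circuits r1 r2 r3" "critical_point ?F (polar_angles P)"
        by (auto simp: critical_circuits_def)
      have "polar_angles P \<in> K"
        using critical_angles[OF r t(1) cubic, of "fst (polar_angles P)" "snd (polar_angles P)"]
          polar_angles_range[of P] P(2) unfolding K_def \<theta>_def by (auto simp: mem_Times_iff)
      then show "P \<in> polar_circuit r1 r2 r3 ` K"
        using polar_circuit_polar_angles[OF P(1)] by (metis imageI)
    qed
    show "polar_circuit r1 r2 r3 ` K \<subseteq> critical_circuits r1 r2 r3 perimeter"
    proof (rule image_subsetI)
      fix \<kappa> assume k: "\<kappa> \<in> K"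
      then have "polar_angles (polar_circuit r1 r2 r3 \<kappa>) = \<kappa>"
        using polar_angles_polar_circuit[OF r(1) r'(1)] K_box by blast
      moreover have "polar_circuit r1 r2 r3 \<kappa> \<in> reduced_circuits r1 r2 r3"
        using range_polar_circuit[OF r(1) r'] by blast
      ultimately show "polar_circuit r1 r2 r3 \<kappa> \<in> critical_circuits r1 r2 r3 perimeter"
        using nondeg[OF k] by (simp add: critical_circuits_def nondegenerate_critical_point_def)
    qed
  qed
  have angles: "polar_angles (polar_circuit r1 r2 r3 \<kappa>) = \<kappa>" if "\<kappa> \<in> K" for \<kappa>
    using polar_angles_polar_circuit[OF r(1) r'(1)] K_box that by blast
  have inj: "inj_on (polar_circuit r1 r2 r3) K"
    using inj_on_subset[OF inj_on_polar_circuit[OF r(1) r'(1)] K_box] .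
  have \<theta>_neq: "\<theta> \<notin> ?par" "- \<theta> \<notin> ?par" "\<theta> \<noteq> - \<theta>"
    using \<theta> pi_gt_zero by (cases \<theta>; auto)+
  have card_par: "card ?par = 4"
    by (simp add: card_cartesian_product)
  have card_K: "card K = 6"
    unfolding K_def using card_par \<theta>_neq by (subst card_Un_disjoint) auto
  have par: "parades r1 r2 r3 = polar_circuit r1 r2 r3 ` ?par"
    by (rule parades_eq[OF r(1) r'])
  have shortest: "shortest_parade r1 r2 r3 = polar_circuit r1 r2 r3 (0, 0)"
    by (simp add: shortest_parade_def polar_circuit_def complex_eq_iff)
  have par_K: "?par \<subseteq> K" by (auto simp: K_def)
  \<comment> \<open>Six points give four values: two parades share \<open>2 * (r2 + r3)\<close>, and
    the mirror triangles share \<open>L\<close>.\<close>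
  have perimeter_K: "perimeter ` polar_circuit r1 r2 r3 ` K = {2 * (r3 - r1), 2 * (r1 + r3), 2 * (r2 + r3), L}"
  proof -
    have "K = {(0, 0), (0, pi), (pi, 0), (pi, pi), \<theta>, - \<theta>}" by (auto simp: K_def)
    then show ?thesis
      using perimeter_parades[OF r] tri(2)[of \<theta>] tri(2)[of "- \<theta>"] unfolding L_def[symmetric] by auto
  qed
  have L_gt: "2 * (r2 + r3) < L" using tri(2,3)[of \<theta>] by (simp add: L_def)
  \<comment> \<open>A maximum is attained at a critical circuit, and \<open>L\<close> is the largest
    of the four critical values.\<close>
  have max: "perimeter P \<le> L" if "P \<in> reduced_circuits r1 r2 r3" for P
  proof -
    obtain M where M: "M \<in> critical_circuits r1 r2 r3 perimeter"
      "\<And>P. P \<in> reduced_circuits r1 r2 r3 \<Longrightarrow> perimeter P \<le> perimeter M"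
      using perimeter_attains_max[OF r] by blast
    have "perimeter M \<in> {2 * (r3 - r1), 2 * (r1 + r3), 2 * (r2 + r3), L}"
      using M(1) perimeter_K crit by blast
    then have "perimeter M \<le> L" using L_gt r by auto
    with M(2)[OF that] show ?thesis by simp
  qed
  show ?thesis
  proof (intro conjI)
    show "morse_function r1 r2 r3 perimeter"
      unfolding morse_function_def crit using smooth_perimeter[OF r] nondeg angles by auto
    show "card (critical_circuits r1 r2 r3 perimeter) = 6"
      unfolding crit using card_image[OF inj] card_K by simp
    show "card (parades r1 r2 r3) = 4"
      unfolding par using card_image[OF inj_on_subset[OF inj par_K]] card_par by simp
    show "shortest_parade r1 r2 r3 \<in> parades r1 r2 r3"
      unfolding par shortest by (rule imageI) simp
    show "\<forall>P \<in> reduced_circuits r1 r2 r3. P \<noteq> shortest_parade r1 r2 r3 \<longrightarrow>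
       perimeter (shortest_parade r1 r2 r3) < perimeter P"
      using shortest_unique_min[OF r] perimeter_parades(1)[OF r] by (simp add: shortest)
    show "\<forall>P \<in> parades r1 r2 r3. P \<noteq> shortest_parade r1 r2 r3 \<longrightarrow> saddle_circuit r1 r2 r3 perimeter P"
    proof (intro ballI impI)
      fix P assume P: "P \<in> parades r1 r2 r3" "P \<noteq> shortest_parade r1 r2 r3"
      then obtain \<kappa> where k: "\<kappa> \<in> ?par" "P = polar_circuit r1 r2 r3 \<kappa>" unfolding par by blast
      with P(2) have "\<kappa> \<noteq> (0, 0)" by (auto simp: shortest)
      moreover have "polar_angles P = \<kappa>" using angles k par_K by blast
      ultimately show "saddle_circuit r1 r2 r3 perimeter P"
        using saddle_point_perimeter[OF r k(1)] P(1) by (simp add: saddle_circuit_def parades_def)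
    qed
    show "\<exists>T1 T2. T1 \<noteq> T2 \<and>
       critical_circuits r1 r2 r3 perimeter = parades r1 r2 r3 \<union> {T1, T2} \<and>
       (\<forall>T \<in> {T1, T2}. nondegenerate_triangle T \<and>
          (\<forall>P \<in> reduced_circuits r1 r2 r3. perimeter P \<le> perimeter T))"
    proof (intro exI conjI)
      show "polar_circuit r1 r2 r3 \<theta> \<noteq> polar_circuit r1 r2 r3 (- \<theta>)"
        using inj \<theta>_neq(3) by (auto simp: K_def dest: inj_onD)
      show "critical_circuits r1 r2 r3 perimeter =
          parades r1 r2 r3 \<union> {polar_circuit r1 r2 r3 \<theta>, polar_circuit r1 r2 r3 (- \<theta>)}"
        unfolding crit par K_def by blast
      show "\<forall>T \<in> {polar_circuit r1 r2 r3 \<theta>, polar_circuit r1 r2 r3 (- \<theta>)}. nondegenerate_triangle T \<and>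
          (\<forall>P \<in> reduced_circuits r1 r2 r3. perimeter P \<le> perimeter T)"
        using tri(2,4) max unfolding L_def by simp
    qed
    show "\<exists>t L\<^sub>m L\<^sub>M.
       (\<forall>s. s > 0 \<and>
            2 * r1 * r2 * r3 * s ^ 3 + (r1\<^sup>2 * r2\<^sup>2 + r2\<^sup>2 * r3\<^sup>2 + r3\<^sup>2 * r1\<^sup>2) * s\<^sup>2
              - r1\<^sup>2 * r2\<^sup>2 * r3\<^sup>2 = 0 \<longleftrightarrow> s = t) \<and>
       L\<^sub>m = 2 * (r3 - r1) \<and>
       L\<^sub>M = sqrt (r1\<^sup>2 + r2\<^sup>2 + 2 * t * r1 * r2 / r3)
           + sqrt (r1\<^sup>2 + r3\<^sup>2 + 2 * t * r1 * r3 / r2)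
           + sqrt (r2\<^sup>2 + r3\<^sup>2 + 2 * t * r2 * r3 / r1) \<and>
       perimeter ` critical_circuits r1 r2 r3 perimeter =
         {L\<^sub>m, 2 * (r1 + r3), 2 * (r2 + r3), L\<^sub>M} \<and>
       L\<^sub>m < 2 * (r1 + r3) \<and> 2 * (r1 + r3) < 2 * (r2 + r3) \<and> 2 * (r2 + r3) < L\<^sub>M"
    proof (intro exI conjI)
      show "\<forall>s. s > 0 \<and>
            2 * r1 * r2 * r3 * s ^ 3 + (r1\<^sup>2 * r2\<^sup>2 + r2\<^sup>2 * r3\<^sup>2 + r3\<^sup>2 * r1\<^sup>2) * s\<^sup>2
              - r1\<^sup>2 * r2\<^sup>2 * r3\<^sup>2 = 0 \<longleftrightarrow> s = t"
        using incircle_cubic_unique[OF r(1) r' _ t(1) _ cubic] cubic t(1) by blast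
      show "perimeter ` critical_circuits r1 r2 r3 perimeter =
         {2 * (r3 - r1), 2 * (r1 + r3), 2 * (r2 + r3), L}"
        unfolding crit by (rule perimeter_K)
    qed (use r L_gt L_def in auto)
  qed
qed

end
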